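(* Consider the deterministic control problem described in the context, and assume all of its standing assumptions (1)--(6). Assume moreover that there exists $\sigma_h>0$ such that $D_h(v\mid u)\ge\frac{\sigma_h}{2}|v-u|^2$ for all $u,v\in U$. Let $L>0$ be a relative-smoothness constant of $J^\tau$, i.e. a constant such that $J^\tau(v)-J^\tau(u)\le dJ^\tau(u)(v-u)+L\,\mathcal{D}_h(v\mid u)$ for all $u,v\in\mathcal{U}$ (such a constant exists under these assumptions). Let $\lambda\ge L$, let $u^0\in\mathcal{U}$, and let $\{u^n\}_{n\ge0}$ be the sequence generated by the mirror descent algorithm with parameter $\lambda$ started from $u^0$. Then $$J^\tau(u^n)-J^\tau(u^{n+1})\ge(\lambda-L)\,\mathcal{D}_h(u^{n+1}\mid u^n)\ge0,\qquad n\ge0.$$ In particular, if $\lambda>L$ and $\inf_{u\in\mathcal{U}}J^\tau(u)>-\infty$, then $\mathcal{D}_h(u^{n+1}\mid u^n)\to0$ as $n\to\infty$.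
   Context: Control problem. Fix $T>0$, $x_0\in\mathbb{R}^d$, $\tau\ge 0$, a set $U\subset\mathbb{R}^m$, and maps $b:[0,T]\times\mathbb{R}^d\times U\to\mathbb{R}^d$, $f:[0,T]\times\mathbb{R}^d\times U\to\mathbb{R}$, $g:\mathbb{R}^d\to\mathbb{R}$, $h:U\to\mathbb{R}$; write $b_t(x,u)=b(t,x,u)$ and $f_t(x,u)=f(t,x,u)$. The control space is $\mathcal{U}:=C([0,T];U)$. For $u\in\mathcal{U}$ the state $x$ is the solution of $\dot x_t=b_t(x_t,u_t)$ on $[0,T]$ with initial value $x_0$. The cost is $$J^\tau(u)=\int_0^T\bigl(f_t(x_t,u_t)+\tau h(u_t)\bigr)\,dt+g(x_T).$$ Hamiltonians: $\mathcal{H}_t^0(x,p,u)=p\cdot b_t(x,u)-f_t(x,u)$ and $\mathcal{H}_t^\tau(x,p,u)=\mathcal{H}_t^0(x,p,u)-\tau h(u)$. The adjoint $p$ associated with $u$ (and its state $x$) is the solution of $\dot p_t=-\nabla_x\mathcal{H}_t^0(x_t,p_t,u_t)$, $p_T=-\nabla g(x_T)$. For every $u\in\mathcal{U}$ the state and adjoint exist and are unique under the standing assumptions. Norms: $|\cdot|$ is the Euclidean norm of vectors and the spectral norm of matrices; $\|\cdot\|$ is the operator norm. Standing assumptions: (1) $U$ is a nonempty, closed, convex subset of $\mathbb{R}^m$. (2) $b$ and $f$ are continuous, and there is $M>0$ such that for $\varphi=b,f$: $|\varphi_t(x,u)-\varphi_t(x',u')|\le M(|x-x'|+|u-u'|)$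 and $|\varphi_t(0,u)|\le M$ for all $t\in[0,T]$, $x,x'\in\mathbb{R}^d$, $u,u'\in U$. (3) For $\varphi=b,f$, $\varphi_t(x,u)$ is twice continuously differentiable in $(x,u)$, and, with the same $M$ (possibly increased), $|\nabla_x\varphi_t(x,u)-\nabla_x\varphi_t(x',u')|\le M(|x-x'|+|u-u'|)$ for all $t,x,x',u,u'$. There are constants $M_{b,uu},M_{f,uu}>0$ with $\|\nabla^2_{uu}b_t(x,u)\|\le M_{b,uu}$ and $\|\nabla^2_{uu}f_t(x,u)\|\le M_{f,uu}$ for all $(t,x,u)$. (Consequently $\nabla_x b,\nabla_u b,\nabla_x f,\nabla_u f$ and $\nabla^2_{xx}b,\nabla^2_{xu}b,\nabla^2_{xx}f,\nabla^2_{xu}f$ are uniformly bounded by $M$.) (4) $g$ is continuously differentiable with $\max\{|g(x)-g(x')|,|\nabla g(x)-\nabla g(x')|\}\le M|x-x'|$ for all $x,x'$, and $|g(0)|\le M$. (5) $h$ is convex and continuously differentiable. (6) There exists $u^*\in\mathcal{U}$ minimizing $J^\tau$ over $\mathcal{U}$. Bregman divergences: $D_h(v\mid u)=h(v)-h(u)-\nabla h(u)\cdot(v-u)$ for $u,v\in U$, and $\mathcal{D}_h(v\mid u)=\int_0^T D_h(v_t\mid u_t)\,dt$ for $u,v\in\mathcal{U}$. Directional derivative: for $u,v\in\mathcal{U}$, $dJ^\tau(u)(v-u):=\lim_{\varepsilon\to0^+}\varepsilon^{-1}\bigl(J^\tau(u+\varepsilon(v-u))-J^\tau(u)\bigr)$;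 under the standing assumptions it exists and equals $-\int_0^T\nabla_u\mathcal{H}_t^\tau(x_t,p_t,u_t)\cdot(v_t-u_t)\,dt$, where $(x,p)$ is the state-adjoint pair of $u$. Mirror descent algorithm (parameter $\lambda>0$, initial guess $u^0\in\mathcal{U}$): for $n=0,1,2,\dots$, let $x^n,p^n$ be the state and adjoint associated with $u^n$, and for every $t\in[0,T]$ let $$u_t^{n+1}\in\arg\max_{v\in U}\Bigl\{\nabla_u\mathcal{H}_t^\tau(x_t^n,p_t^n,u_t^n)\cdot(v-u_t^n)-\lambda D_h(v\mid u_t^n)\Bigr\},$$ where $\nabla_u\mathcal{H}_t^\tau(x,p,u)=\nabla_u b_t(x,u)^\top p-\nabla_u f_t(x,u)-\tau\nabla h(u)$. Under the standing assumptions and uniform convexity of $h$, the maximizer exists, is unique, and $u^n\in\mathcal{U}$ for all $n$. *)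

theory Defs
  imports "HOL-Analysis.Analysis"
begin

text \<open>
  State and control spaces are Euclidean spaces; the maps below are total functions, of which only
  the values for times in \<open>{0..T}\<close> and control values in \<open>U\<close> matter. Derivatives with respect to
  the control are taken within \<open>U\<close>, which is closed and convex but not open. If \<open>U\<close> has empty
  interior, a gradient within \<open>U\<close> is not unique; its inner product with \<open>v - u\<close>, for \<open>u, v \<in> U\<close>,
  is, and gradients with respect to the control are used only in this way.
\<close>

definition gradient_within :: "('a::euclidean_space \<Rightarrow> real) \<Rightarrow> 'a set \<Rightarrow> 'a \<Rightarrow> 'a" where
  "gradient_within \<phi> S z = (SOME D. (\<phi> has_derivative (\<lambda>w. D \<bullet> w)) (at z within S))"

abbreviation gradient :: "('a::euclidean_space \<Rightarrow> real) \<Rightarrow> 'a \<Rightarrow> 'a" where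
  "gradient \<phi> \<equiv> gradient_within \<phi> UNIV"

definition C1_on :: "'a::euclidean_space set \<Rightarrow> ('a \<Rightarrow> real) \<Rightarrow> bool" where
  "C1_on S \<phi> \<longleftrightarrow> (\<exists>\<phi>'. (\<forall>z\<in>S. (\<phi> has_derivative (\<lambda>w. \<phi>' z \<bullet> w)) (at z within S)) \<and>
                       continuous_on S \<phi>')"

definition C2_on ::
  "'a::real_normed_vector set \<Rightarrow> ('a \<Rightarrow> 'b::real_normed_vector) \<Rightarrow>
    ('a \<Rightarrow> 'a \<Rightarrow>\<^sub>L 'b) \<Rightarrow> ('a \<Rightarrow> 'a \<Rightarrow>\<^sub>L ('a \<Rightarrow>\<^sub>L 'b)) \<Rightarrow> bool" where
  "C2_on S \<phi> \<phi>' \<phi>'' \<longleftrightarrow>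
     (\<forall>z\<in>S. (\<phi> has_derivative blinfun_apply (\<phi>' z)) (at z within S)) \<and>
     (\<forall>z\<in>S. (\<phi>' has_derivative blinfun_apply (\<phi>'' z)) (at z within S)) \<and>
     continuous_on S \<phi>''"

definition controls :: "real \<Rightarrow> 'u::euclidean_space set \<Rightarrow> (real \<Rightarrow> 'u) set" where
  "controls T U = {u. continuous_on {0..T} u \<and> u ` {0..T} \<subseteq> U}"

definition is_state ::
  "real \<Rightarrow> 'x::euclidean_space \<Rightarrow> (real \<Rightarrow> 'x \<Rightarrow> 'u::euclidean_space \<Rightarrow> 'x) \<Rightarrow>
    (real \<Rightarrow> 'u) \<Rightarrow> (real \<Rightarrow> 'x) \<Rightarrow> bool" where
  "is_state T x0 b u x \<longleftrightarrow> x 0 = x0 \<and>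
     (\<forall>t\<in>{0..T}. (x has_vector_derivative b t (x t) (u t)) (at t within {0..T}))"

text \<open>
  Solutions exist and are unique on \<open>{0..T}\<close> under the assumptions below, so the choice in
  \<open>state\<close> and \<open>costate\<close> only concerns times outside \<open>{0..T}\<close>.
\<close>

definition state ::
  "real \<Rightarrow> 'x::euclidean_space \<Rightarrow> (real \<Rightarrow> 'x \<Rightarrow> 'u::euclidean_space \<Rightarrow> 'x) \<Rightarrow>
    (real \<Rightarrow> 'u) \<Rightarrow> real \<Rightarrow> 'x" where
  "state T x0 b u = (SOME x. is_state T x0 b u x)"

definition cost ::
  "real \<Rightarrow> 'x::euclidean_space \<Rightarrow> real \<Rightarrow> (real \<Rightarrow> 'x \<Rightarrow> 'u::euclidean_space \<Rightarrow> 'x) \<Rightarrow>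
    (real \<Rightarrow> 'x \<Rightarrow> 'u \<Rightarrow> real) \<Rightarrow> ('x \<Rightarrow> real) \<Rightarrow> ('u \<Rightarrow> real) \<Rightarrow> (real \<Rightarrow> 'u) \<Rightarrow> real" where
  "cost T x0 \<tau> b f g h u =
     (let x = state T x0 b u
      in integral {0..T} (\<lambda>t. f t (x t) (u t) + \<tau> * h (u t)) + g (x T))"

definition hamiltonian0 ::
  "(real \<Rightarrow> 'x::euclidean_space \<Rightarrow> 'u::euclidean_space \<Rightarrow> 'x) \<Rightarrow> (real \<Rightarrow> 'x \<Rightarrow> 'u \<Rightarrow> real) \<Rightarrow>
    real \<Rightarrow> 'x \<Rightarrow> 'x \<Rightarrow> 'u \<Rightarrow> real" where
  "hamiltonian0 b f t x p u = p \<bullet> b t x u - f t x u"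

definition hamiltonian ::
  "real \<Rightarrow> (real \<Rightarrow> 'x::euclidean_space \<Rightarrow> 'u::euclidean_space \<Rightarrow> 'x) \<Rightarrow>
    (real \<Rightarrow> 'x \<Rightarrow> 'u \<Rightarrow> real) \<Rightarrow> ('u \<Rightarrow> real) \<Rightarrow> real \<Rightarrow> 'x \<Rightarrow> 'x \<Rightarrow> 'u \<Rightarrow> real" where
  "hamiltonian \<tau> b f h t x p u = hamiltonian0 b f t x p u - \<tau> * h u"

definition is_costate ::
  "real \<Rightarrow> (real \<Rightarrow> 'x::euclidean_space \<Rightarrow> 'u::euclidean_space \<Rightarrow> 'x) \<Rightarrow>
    (real \<Rightarrow> 'x \<Rightarrow> 'u \<Rightarrow> real) \<Rightarrow> ('x \<Rightarrow> real) \<Rightarrow>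
    (real \<Rightarrow> 'u) \<Rightarrow> (real \<Rightarrow> 'x) \<Rightarrow> (real \<Rightarrow> 'x) \<Rightarrow> bool" where
  "is_costate T b f g u x p \<longleftrightarrow> p T = - gradient g (x T) \<and>
     (\<forall>t\<in>{0..T}. (p has_vector_derivative
        - gradient (\<lambda>y. hamiltonian0 b f t y (p t) (u t)) (x t)) (at t within {0..T}))"

definition costate ::
  "real \<Rightarrow> 'x::euclidean_space \<Rightarrow> (real \<Rightarrow> 'x \<Rightarrow> 'u::euclidean_space \<Rightarrow> 'x) \<Rightarrow>
    (real \<Rightarrow> 'x \<Rightarrow> 'u \<Rightarrow> real) \<Rightarrow> ('x \<Rightarrow> real) \<Rightarrow> (real \<Rightarrow> 'u) \<Rightarrow> real \<Rightarrow> 'x" where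
  "costate T x0 b f g u = (SOME p. is_costate T b f g u (state T x0 b u) p)"

definition bregman ::
  "'u::euclidean_space set \<Rightarrow> ('u \<Rightarrow> real) \<Rightarrow> 'u \<Rightarrow> 'u \<Rightarrow> real" where
  "bregman U h v u = h v - h u - gradient_within h U u \<bullet> (v - u)"

definition path_bregman ::
  "real \<Rightarrow> 'u::euclidean_space set \<Rightarrow> ('u \<Rightarrow> real) \<Rightarrow> (real \<Rightarrow> 'u) \<Rightarrow> (real \<Rightarrow> 'u) \<Rightarrow> real" where
  "path_bregman T U h v u = integral {0..T} (\<lambda>t. bregman U h (v t) (u t))"

definition directional_derivative ::
  "((real \<Rightarrow> 'u::euclidean_space) \<Rightarrow> real) \<Rightarrow> (real \<Rightarrow> 'u) \<Rightarrow> (real \<Rightarrow> 'u) \<Rightarrow> real" where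
  "directional_derivative J u w =
     Lim (at_right 0) (\<lambda>\<epsilon>. (J (\<lambda>t. u t + \<epsilon> *\<^sub>R w t) - J u) / \<epsilon>)"

definition relatively_smooth ::
  "real \<Rightarrow> 'u::euclidean_space set \<Rightarrow> ('u \<Rightarrow> real) \<Rightarrow> ((real \<Rightarrow> 'u) \<Rightarrow> real) \<Rightarrow> real \<Rightarrow> bool" where
  "relatively_smooth T U h J L \<longleftrightarrow>
     (\<forall>u\<in>controls T U. \<forall>v\<in>controls T U.
        J v - J u \<le> directional_derivative J u (\<lambda>t. v t - u t) + L * path_bregman T U h v u)"

definition mirror_descent ::
  "real \<Rightarrow> 'x::euclidean_space \<Rightarrow> real \<Rightarrow> 'u::euclidean_space set \<Rightarrow>
    (real \<Rightarrow> 'x \<Rightarrow> 'u \<Rightarrow> 'x) \<Rightarrow> (real \<Rightarrow> 'x \<Rightarrow> 'u \<Rightarrow> real) \<Rightarrow> ('x \<Rightarrow> real) \<Rightarrow> ('u \<Rightarrow> real) \<Rightarrow>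
    real \<Rightarrow> (real \<Rightarrow> 'u) \<Rightarrow> (nat \<Rightarrow> real \<Rightarrow> 'u) \<Rightarrow> bool" where
  "mirror_descent T x0 \<tau> U b f g h lam u0 u \<longleftrightarrow> u 0 = u0 \<and>
     (\<forall>n. let x = state T x0 b (u n); p = costate T x0 b f g (u n) in
       \<forall>t\<in>{0..T}.
         is_arg_max
           (\<lambda>v. gradient_within (hamiltonian \<tau> b f h t (x t) (p t)) U (u n t) \<bullet> (v - u n t)
                 - lam * bregman U h v (u n t))
           (\<lambda>v. v \<in> U) (u (Suc n) t))"

text \<open>
  Conditions on a coefficient \<open>\<phi>\<close>, used for both the drift and the running cost. Second-order
  differentiability is in \<open>(x, u)\<close> for each fixed time. Increments of the partial derivative in \<open>x\<close>
  are measured by the operator norm, and the last clause says that the operator norm of the second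
  partial derivative in \<open>u\<close> is at most \<open>Muu\<close>.
\<close>

definition regular_coefficient ::
  "real \<Rightarrow> 'u::euclidean_space set \<Rightarrow> real \<Rightarrow> real \<Rightarrow>
    (real \<Rightarrow> 'x::euclidean_space \<Rightarrow> 'u \<Rightarrow> 'y::euclidean_space) \<Rightarrow> bool" where
  "regular_coefficient T U M Muu \<phi> \<longleftrightarrow>
     continuous_on ({0..T} \<times> UNIV \<times> U) (\<lambda>(t, x, u). \<phi> t x u) \<and>
     (\<forall>t\<in>{0..T}. \<forall>x x'. \<forall>u\<in>U. \<forall>u'\<in>U.
        norm (\<phi> t x u - \<phi> t x' u') \<le> M * (norm (x - x') + norm (u - u'))) \<and>
     (\<forall>t\<in>{0..T}. \<forall>u\<in>U. norm (\<phi> t 0 u) \<le> M) \<and>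
     (\<exists>\<phi>' \<phi>''. \<forall>t\<in>{0..T}.
        C2_on (UNIV \<times> U) (\<lambda>(x, u). \<phi> t x u) (\<phi>' t) (\<phi>'' t) \<and>
        (\<forall>x x'. \<forall>u\<in>U. \<forall>u'\<in>U.
           onorm (\<lambda>\<xi>. blinfun_apply (\<phi>' t (x, u)) (\<xi>, 0) - blinfun_apply (\<phi>' t (x', u')) (\<xi>, 0))
             \<le> M * (norm (x - x') + norm (u - u'))) \<and>
        (\<forall>x. \<forall>u\<in>U. \<forall>v w.
           norm (blinfun_apply (blinfun_apply (\<phi>'' t (x, u)) (0, v)) (0, w))
             \<le> Muu * norm v * norm w))"

locale control_problem =
  fixes T :: real
    and x0 :: "'x::euclidean_space"
    and \<tau> :: real
    and U :: "'u::euclidean_space set"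
    and b :: "real \<Rightarrow> 'x \<Rightarrow> 'u \<Rightarrow> 'x"
    and f :: "real \<Rightarrow> 'x \<Rightarrow> 'u \<Rightarrow> real"
    and g :: "'x \<Rightarrow> real"
    and h :: "'u \<Rightarrow> real"
    and M Mbuu Mfuu :: real
  assumes T_pos: "T > 0"
    and tau_nonneg: "\<tau> \<ge> 0"
    and U_nonempty: "U \<noteq> {}"
    and U_closed: "closed U"
    and U_convex: "convex U"
    and M_pos: "M > 0"
    and Mbuu_pos: "Mbuu > 0"
    and Mfuu_pos: "Mfuu > 0"
    and b_regular: "regular_coefficient T U M Mbuu b"
    and f_regular: "regular_coefficient T U M Mfuu f"
    and g_C1: "C1_on UNIV g"
    and g_bounds: "\<And>x x'. max \<bar>g x - g x'\<bar> (norm (gradient g x - gradient g x')) \<le> M * norm (x - x')"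
    and g_zero: "\<bar>g 0\<bar> \<le> M"
    and h_convex: "convex_on U h"
    and h_C1: "C1_on U h"
    and minimizer: "\<exists>u. is_arg_min (cost T x0 \<tau> b f g h) (\<lambda>u. u \<in> controls T U) u"

end

theory Submission
  imports Defs
begin

text \<open>
  Testing the arg max against \<open>v = u\<^sup>n\<close> at each time and integrating gives
  \<open>dJ(u\<^sup>n)(u\<^sup>n\<^sup>+\<^sup>1 - u\<^sup>n) \<le> - lam D\<^sub>h(u\<^sup>n\<^sup>+\<^sup>1 | u\<^sup>n)\<close>, and relative smoothness turns this into the
  descent inequality; the last claim follows by telescoping. Two points need work. The directional
  derivative must be identified with the integral of the Hamiltonian gradient, which is done by
  duality with the adjoint and an estimate of order \<open>\<epsilon>\<close> on the state perturbation. The iterates must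
  remain continuous, which follows from the strong concavity of the maximized function and from the
  continuity in time of its linear part.
\<close>

section \<open>Ordinary differential equations\<close>

text \<open>States and adjoints are values of \<open>SOME\<close>, so existence must be proved
  before anything is known about them, and for the adjoint this already requires coefficients that
  are continuous in time. But \<open>b\<close> and \<open>f\<close> are twice differentiable in
  \<open>(x, u)\<close> only for each fixed time. Continuity in time of their derivatives is
  recovered from difference quotients, which inherit continuity from \<open>b\<close> and
  \<open>f\<close> and converge uniformly because the Taylor remainder is quadratic with a constant
  independent of time. \<open>h\<close> is merely C1, so its quotients come without a rate, and
  compactness of \<open>{0..T} \<times> {0..1}\<close> takes over. Gradients within \<open>U\<close>
  are choices as well, possibly irregular in time and determined only on feasible directions; hence
  the computations use linear functionals applied to differences of points of \<open>U\<close>.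
  Continuity of the iterates is no formality: relative smoothness and the derivative formula are
  available for pairs of continuous controls, while the algorithm picks the values separately at
  each time.\<close>

lemma integral_exp_le:
  fixes K t :: real
  assumes "K > 0" "t \<ge> 0"
  shows "(\<lambda>s. exp (K * s)) integrable_on {0..t}"
    and "integral {0..t} (\<lambda>s. exp (K * s)) \<le> exp (K * t) / K"
proof -
  have "((\<lambda>s. exp (K * s)) has_integral exp (K * t) / K - exp (K * 0) / K) {0..t}"
    using assms
    by (intro fundamental_theorem_of_calculus)
       (auto intro!: derivative_eq_intros simp flip: has_real_derivative_iff_has_vector_derivative)
  then show "(\<lambda>s. exp (K * s)) integrable_on {0..t}"
    and "integral {0..t} (\<lambda>s. exp (K * s)) \<le> exp (K * t) / K"
    using assms by (auto simp: has_integral_iff)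
qed

text \<open>Picard's operator becomes a contraction in the sup norm after weighting by \<open>exp (- 2 * K * t)\<close>.\<close>

lemma lipschitz_ode_solution_exists:
  fixes F :: "real \<Rightarrow> 'a::euclidean_space \<Rightarrow> 'a"
  assumes "T > 0" "K > 0"
    and cont: "continuous_on ({0..T} \<times> UNIV) (\<lambda>(t, y). F t y)"
    and lip: "\<And>t y z. t \<in> {0..T} \<Longrightarrow> norm (F t y - F t z) \<le> K * norm (y - z)"
  shows "\<exists>y. y 0 = y0 \<and> (\<forall>t\<in>{0..T}. (y has_vector_derivative F t (y t)) (at t within {0..T}))"
proof -
  \<comment> \<open>\<open>z\<close> stands for the weighted solution
    \<open>exp (- (2 * K * t)) *\<^sub>R y t\<close>, so the plain sup norm of \<open>z\<close> is
    the weighted norm of \<open>y\<close>.\<close>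
  define G where "G z s = F s (exp (2 * K * s) *\<^sub>R apply_bcontfun z s)" for z s
  define P where "P z t = exp (- (2 * K * t)) *\<^sub>R (y0 + integral {0..t} (G z))" for z t
  have Gc: "continuous_on {0..T} (G z)" for z
    unfolding G_def
    by (rule continuous_on_compose2[OF cont, where f = "\<lambda>s. (s, exp (2 * K * s) *\<^sub>R apply_bcontfun z s)",
            simplified]) (auto intro!: continuous_intros)
  have Gi: "G z integrable_on {0..t}" if "t \<in> {0..T}" for z t
    using that by (intro integrable_continuous_real continuous_on_subset[OF Gc]) auto
  have Pc: "continuous_on {0..T} (P z)" for z
    unfolding P_def
    by (intro continuous_intros indefinite_integral_continuous_1) (use Gi \<open>T > 0\<close> in auto)
  \<comment> \<open>Bounded continuous functions live on the whole line. Clamping extends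
    \<open>P z\<close> from \<open>{0..T}\<close> and so yields a self-map of a complete
    space.\<close>
  have "\<exists>w. \<forall>x. apply_bcontfun w x = P z (clamp 0 T x)" for z
    using continuous_on_cbox_bcontfunE[of 0 T "P z"] Pc by (metis interval_cbox)
  then obtain \<Phi> where \<Phi>: "apply_bcontfun (\<Phi> z) x = P z (clamp 0 T x)" for z x
    by metis
  have "dist (\<Phi> z) (\<Phi> w) \<le> 1 / 2 * dist z w" for z w
  proof (rule dist_bound)
    fix r :: real
    define t where "t = clamp 0 T r"
    have t: "t \<in> {0..T}"
      using clamp_in_interval[of 0 T r] \<open>T > 0\<close> by (simp add: t_def)
    have "norm (integral {0..t} (\<lambda>s. G z s - G w s)) \<le> integral {0..t} (\<lambda>s. K * dist z w * exp (2 * K * s))"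
    proof (rule integral_norm_bound_integral)
      show "(\<lambda>s. G z s - G w s) integrable_on {0..t}"
        by (intro integrable_diff Gi t)
      show "(\<lambda>s. K * dist z w * exp (2 * K * s)) integrable_on {0..t}"
        by (intro integrable_continuous_real continuous_intros)
      fix s assume "s \<in> {0..t}"
      then have "norm (G z s - G w s)
          \<le> K * norm (exp (2 * K * s) *\<^sub>R apply_bcontfun z s - exp (2 * K * s) *\<^sub>R apply_bcontfun w s)"
        unfolding G_def using t by (intro lip) auto
      also have "\<dots> = K * (exp (2 * K * s) * dist (apply_bcontfun z s) (apply_bcontfun w s))"
        by (simp add: dist_norm flip: scaleR_diff_right)
      also have "\<dots> \<le> K * (exp (2 * K * s) * dist z w)"
        using \<open>K > 0\<close> dist_bounded by (intro mult_left_mono) auto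
      finally show "norm (G z s - G w s) \<le> K * dist z w * exp (2 * K * s)"
        by (simp add: mult_ac)
    qed
    \<comment> \<open>The doubled exponent pays off here: \<open>K / (2 * K)\<close> is the
      contraction factor.\<close>
    also have "\<dots> \<le> K * dist z w * (exp (2 * K * t) / (2 * K))"
      unfolding integral_mult_right
      using \<open>K > 0\<close> t by (intro mult_left_mono integral_exp_le) auto
    also have "\<dots> = exp (2 * K * t) * (1 / 2 * dist z w)"
      using \<open>K > 0\<close> by (simp add: field_simps)
    finally have *: "norm (integral {0..t} (G z) - integral {0..t} (G w))
        \<le> exp (2 * K * t) * (1 / 2 * dist z w)"
      by (subst (asm) integral_diff) (use Gi t in auto)
    have "dist (P z t) (P w t)
        = exp (- (2 * K * t)) * norm (integral {0..t} (G z) - integral {0..t} (G w))"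
      by (simp add: P_def dist_norm flip: scaleR_diff_right)
    also have "\<dots> \<le> exp (- (2 * K * t)) * (exp (2 * K * t) * (1 / 2 * dist z w))"
      using * by (intro mult_left_mono) auto
    also have "\<dots> = 1 / 2 * dist z w"
      by (simp add: exp_minus)
    finally show "dist (apply_bcontfun (\<Phi> z) r) (apply_bcontfun (\<Phi> w) r) \<le> 1 / 2 * dist z w"
      by (simp add: \<Phi> t_def)
  qed
  then have "\<exists>!z\<in>UNIV. \<Phi> z = z"
    by (intro Banach_fix[where c = "1 / 2"]) (auto simp: complete_UNIV)
  then obtain z where z: "\<Phi> z = z" by auto
  define y where "y t = exp (2 * K * t) *\<^sub>R apply_bcontfun z t" for t
  have y: "y t = y0 + integral {0..t} (G z)" if "t \<in> {0..T}" for t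
  proof -
    have "apply_bcontfun z t = P z t"
      using \<Phi>[of z t] that by (simp add: z)
    then show ?thesis
      by (simp add: y_def P_def flip: exp_add)
  qed
  have "(y has_vector_derivative F t (y t)) (at t within {0..T})" if "t \<in> {0..T}" for t
  proof -
    have "((\<lambda>t. y0 + integral {0..t} (G z)) has_vector_derivative 0 + G z t) (at t within {0..T})"
      by (intro has_vector_derivative_add has_vector_derivative_const
          integral_has_vector_derivative[OF Gc that])
    then have "(y has_vector_derivative G z t) (at t within {0..T})"
      by (intro has_vector_derivative_transform[OF that, of y]) (use y in auto)
    then show ?thesis
      by (simp add: G_def y_def)
  qed
  moreover have "y 0 = y0"
    using y[of 0] \<open>T > 0\<close> by simp
  ultimately show ?thesis
    by blast
qed

text \<open>The same weight absorbs the integral term into half of the maximum of the left-hand side.\<close>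

lemma gronwall_bound:
  fixes d :: "real \<Rightarrow> 'a::euclidean_space"
  assumes "T \<ge> 0" "K > 0" "c \<ge> 0"
    and d0: "d 0 = 0"
    and der: "\<And>t. t \<in> {0..T} \<Longrightarrow> (d has_vector_derivative d' t) (at t within {0..T})"
    and bound: "\<And>t. t \<in> {0..T} \<Longrightarrow> norm (d' t) \<le> K * (norm (d t) + c)"
    and t: "t \<in> {0..T}"
  shows "norm (d t) \<le> 2 * K * T * exp (2 * K * T) * c"
proof -
  have dc: "continuous_on {0..T} d"
    using der has_vector_derivative_continuous continuous_on_eq_continuous_within by blast
  define q where "q t = exp (- (2 * K * t)) * norm (d t)" for t
  have "\<exists>r\<in>{0..T}. \<forall>t\<in>{0..T}. q t \<le> q r"
    using \<open>T \<ge> 0\<close> unfolding q_def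
    by (intro continuous_attains_sup continuous_intros dc) auto
  then obtain r where r: "r \<in> {0..T}" and q: "\<And>t. t \<in> {0..T} \<Longrightarrow> q t \<le> q r"
    by blast
  have nd: "norm (d t) = exp (2 * K * t) * q t" for t
    by (simp add: q_def exp_minus)
  have hi: "(d' has_integral d r - d 0) {0..r}"
    using r by (intro fundamental_theorem_of_calculus has_vector_derivative_within_subset[OF der]) auto
  have "norm (d r) = norm (integral {0..r} d')"
    using hi d0 by (simp add: has_integral_iff)
  also have "\<dots> \<le> integral {0..r} (\<lambda>s. K * q r * exp (2 * K * s) + K * c)"
  proof (rule integral_norm_bound_integral)
    show "d' integrable_on {0..r}" using hi by auto
    show "(\<lambda>s. K * q r * exp (2 * K * s) + K * c) integrable_on {0..r}"
      by (intro integrable_continuous_real continuous_intros)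
    fix s assume s: "s \<in> {0..r}"
    then have "norm (d' s) \<le> K * (norm (d s) + c)"
      using r by (intro bound) auto
    also have "norm (d s) \<le> exp (2 * K * s) * q r"
      unfolding nd using q s r by (intro mult_left_mono) auto
    finally show "norm (d' s) \<le> K * q r * exp (2 * K * s) + K * c"
      using \<open>K > 0\<close> by (simp add: algebra_simps)
  qed
  also have "\<dots> = K * q r * integral {0..r} (\<lambda>s. exp (2 * K * s)) + K * c * r"
    using r by (subst integral_add) (auto intro!: integrable_continuous_real continuous_intros)
  also have "\<dots> \<le> K * q r * (exp (2 * K * r) / (2 * K)) + K * c * T"
    using \<open>K > 0\<close> \<open>c \<ge> 0\<close> r
    by (intro add_mono mult_left_mono integral_exp_le) (auto simp: q_def)
  also have "\<dots> = norm (d r) / 2 + K * c * T"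
    using \<open>K > 0\<close> by (simp add: nd)
  finally have dr: "norm (d r) \<le> 2 * K * c * T"
    by simp
  \<comment> \<open>The weight is at most 1, so the bound at the maximizer \<open>r\<close> also
    bounds \<open>q\<close>. Undoing the weight at \<open>t\<close> then costs the factor
    \<open>exp (2 * K * T)\<close>.\<close>
  have "q r \<le> norm (d r)"
    unfolding q_def using r \<open>K > 0\<close> by (simp add: mult_left_le_one_le)
  then have "q r \<le> 2 * K * c * T"
    using dr by simp
  have "norm (d t) \<le> exp (2 * K * t) * q r"
    unfolding nd using q t by (intro mult_left_mono) auto
  also have "\<dots> \<le> exp (2 * K * T) * (2 * K * c * T)"
    using t \<open>K > 0\<close> \<open>q r \<le> 2 * K * c * T\<close> by (intro mult_mono) (auto simp: q_def)
  finally show ?thesis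
    by (simp add: mult_ac)
qed

section \<open>Derivatives within convex sets\<close>

text \<open>Restriction to a segment turns derivatives within a convex set into derivatives on
  \<open>{0..1}\<close>, where uniqueness and mean value bounds are available even if
  \<open>S\<close> has empty interior.\<close>

lemma has_vector_derivative_along_segment:
  fixes \<phi> :: "'a::real_normed_vector \<Rightarrow> 'b::real_normed_vector"
  assumes "convex S" "u \<in> S" "v \<in> S" "e \<in> {0..1}"
    and der: "(\<phi> has_derivative D) (at (u + e *\<^sub>R (v - u)) within S)"
  shows "((\<lambda>e. \<phi> (u + e *\<^sub>R (v - u))) has_vector_derivative D (v - u)) (at e within {0..1})"
proof -
  have sub: "(\<lambda>e. u + e *\<^sub>R (v - u)) ` {0..1} \<subseteq> S"
    using convex_alt[of S] assms(1-3) by (fastforce simp: algebra_simps)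
  have "((\<lambda>e. \<phi> (u + e *\<^sub>R (v - u))) has_derivative (\<lambda>s. D (s *\<^sub>R (v - u)))) (at e within {0..1})"
    by (rule has_derivative_in_compose[where g = \<phi> and f = "\<lambda>e. u + e *\<^sub>R (v - u)"])
       (auto intro!: derivative_eq_intros has_derivative_subset[OF der sub])
  moreover have "D (s *\<^sub>R (v - u)) = s *\<^sub>R D (v - u)" for s
    using der has_derivative_linear linear_scale by blast
  ultimately show ?thesis
    by (simp add: has_vector_derivative_def)
qed

text \<open>Both derivatives induce the one-sided derivative at the endpoint \<open>0\<close> of the
  segment from \<open>u\<close> to \<open>v\<close>, and that one is unique.\<close>

lemma has_derivative_unique_convex:
  assumes "convex S" "u \<in> S" "v \<in> S"
    and "(\<phi> has_derivative D) (at u within S)" "(\<phi> has_derivative D') (at u within S)"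
  shows "D (v - u) = D' (v - u)"
  using vector_derivative_unique_within_closed_interval[of 0 1 0 "\<lambda>e. \<phi> (u + e *\<^sub>R (v - u))"]
    has_vector_derivative_along_segment[of S u v 0 \<phi> D]
    has_vector_derivative_along_segment[of S u v 0 \<phi> D'] assms
  by simp

lemma inner_sum_Basis_linear:
  fixes D :: "'a::euclidean_space \<Rightarrow> real"
  assumes "linear D"
  shows "(\<Sum>i\<in>Basis. D i *\<^sub>R i) \<bullet> w = D w"
proof -
  have "D w = D (\<Sum>i\<in>Basis. (w \<bullet> i) *\<^sub>R i)"
    by (simp add: euclidean_representation)
  also have "\<dots> = (\<Sum>i\<in>Basis. (w \<bullet> i) * D i)"
    using assms by (simp add: linear_sum linear_scale)
  finally show ?thesis
    by (simp add: inner_sum_left inner_commute[of w] mult.commute)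
qed

text \<open>Riesz representation of \<open>D\<close> provides a witness for the choice in
  \<open>gradient_within\<close>, so the chosen vector is itself a derivative.\<close>

lemma has_derivative_gradient_within:
  assumes "(\<phi> has_derivative D) (at u within S)"
  shows "(\<phi> has_derivative (\<lambda>w. gradient_within \<phi> S u \<bullet> w)) (at u within S)"
proof -
  have "(\<phi> has_derivative (\<lambda>w. (\<Sum>i\<in>Basis. D i *\<^sub>R i) \<bullet> w)) (at u within S)"
    using assms inner_sum_Basis_linear[OF has_derivative_linear[OF assms]] by simp
  then show ?thesis
    unfolding gradient_within_def by (rule someI)
qed

lemma gradient_within_inner:
  assumes "convex S" "u \<in> S" "v \<in> S" "(\<phi> has_derivative D) (at u within S)"
  shows "gradient_within \<phi> S u \<bullet> (v - u) = D (v - u)"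
  by (rule has_derivative_unique_convex[OF assms(1-3) has_derivative_gradient_within[OF assms(4)] assms(4)])

lemma gradient_inner:
  assumes "(\<phi> has_derivative D) (at u)"
  shows "gradient \<phi> u \<bullet> w = D w"
  using gradient_within_inner[of UNIV u "u + w"] assms by simp

section \<open>Expansion of the coefficients\<close>

text \<open>
  The only consequence of the regularity of the coefficients that is used: a Taylor expansion with a
  quadratic remainder, uniform in time. It also yields the continuity in time of the partial
  derivatives, which is not among the assumptions.
\<close>

definition uniform_expansion ::
  "real \<Rightarrow> 'u::euclidean_space set \<Rightarrow> (real \<Rightarrow> 'x::euclidean_space \<Rightarrow> 'u \<Rightarrow> 'y::euclidean_space) \<Rightarrow>
    (real \<Rightarrow> 'x \<Rightarrow> 'u \<Rightarrow> 'x \<Rightarrow> 'y) \<Rightarrow> (real \<Rightarrow> 'x \<Rightarrow> 'u \<Rightarrow> 'u \<Rightarrow> 'y) \<Rightarrow> real \<Rightarrow> bool" where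
  "uniform_expansion T U \<phi> \<phi>x \<phi>u C \<longleftrightarrow>
     C \<ge> 0 \<and> continuous_on ({0..T} \<times> UNIV \<times> U) (\<lambda>(t, x, u). \<phi> t x u) \<and>
     (\<forall>t\<in>{0..T}. \<forall>x. \<forall>u\<in>U.
        ((\<lambda>y. \<phi> t y u) has_derivative \<phi>x t x u) (at x) \<and>
        (\<phi> t x has_derivative \<phi>u t x u) (at u within U) \<and>
        (\<forall>x'. \<forall>u'\<in>U. norm (\<phi> t x' u' - \<phi> t x u - \<phi>x t x u (x' - x) - \<phi>u t x u (u' - u))
            \<le> C * (norm (x' - x) + norm (u' - u))\<^sup>2))"

lemma uniform_expansionD:
  assumes "uniform_expansion T U \<phi> \<phi>x \<phi>u C"
  shows "C \<ge> 0"
    and "continuous_on ({0..T} \<times> UNIV \<times> U) (\<lambda>(t, x, u). \<phi> t x u)"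
    and "\<And>t x u. t \<in> {0..T} \<Longrightarrow> u \<in> U \<Longrightarrow> ((\<lambda>y. \<phi> t y u) has_derivative \<phi>x t x u) (at x)"
    and "\<And>t x u. t \<in> {0..T} \<Longrightarrow> u \<in> U \<Longrightarrow> (\<phi> t x has_derivative \<phi>u t x u) (at u within U)"
    and "\<And>t x x' u u'. t \<in> {0..T} \<Longrightarrow> u \<in> U \<Longrightarrow> u' \<in> U \<Longrightarrow>
      norm (\<phi> t x' u' - \<phi> t x u - \<phi>x t x u (x' - x) - \<phi>u t x u (u' - u))
        \<le> C * (norm (x' - x) + norm (u' - u))\<^sup>2"
    and "\<And>t x u. t \<in> {0..T} \<Longrightarrow> u \<in> U \<Longrightarrow> linear (\<phi>x t x u)"
    and "\<And>t x u. t \<in> {0..T} \<Longrightarrow> u \<in> U \<Longrightarrow> linear (\<phi>u t x u)"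
proof -
  show dx: "\<And>t x u. t \<in> {0..T} \<Longrightarrow> u \<in> U \<Longrightarrow> ((\<lambda>y. \<phi> t y u) has_derivative \<phi>x t x u) (at x)"
    and du: "\<And>t x u. t \<in> {0..T} \<Longrightarrow> u \<in> U \<Longrightarrow> (\<phi> t x has_derivative \<phi>u t x u) (at u within U)"
    using assms by (simp_all add: uniform_expansion_def)
  show "\<And>t x u. t \<in> {0..T} \<Longrightarrow> u \<in> U \<Longrightarrow> linear (\<phi>x t x u)"
    and "\<And>t x u. t \<in> {0..T} \<Longrightarrow> u \<in> U \<Longrightarrow> linear (\<phi>u t x u)"
    by (rule has_derivative_linear[OF dx] has_derivative_linear[OF du]; assumption)+
qed (use assms in \<open>simp_all add: uniform_expansion_def\<close>)

lemma continuous_on_paths: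
  assumes "continuous_on ({0..T} \<times> UNIV \<times> U) (\<lambda>(t, x, u). \<phi> t x u)"
    and "continuous_on {0..T} x" "u \<in> controls T U"
  shows "continuous_on {0..T} (\<lambda>t. \<phi> t (x t) (u t))"
  by (rule continuous_on_compose2[OF assms(1), where f = "\<lambda>t. (t, x t, u t)", simplified])
     (use assms(2,3) in \<open>auto simp: controls_def intro!: continuous_intros\<close>)

text \<open>The increment is split in a definite order: move in \<open>x\<close> at the new control
  \<open>u'\<close>, replace the x-derivative at \<open>u'\<close> by the one at \<open>u\<close>,
  then move in \<open>u\<close> at the old \<open>x\<close>. The first two pieces are controlled by
  the Lipschitz bound \<open>M\<close> on the x-derivative, the last by \<open>Muu\<close>. With
  \<open>a\<close>, \<open>c\<close> the sizes of the two moves, the sum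
  \<open>M * a^2 + M * a * c + Muu * c^2\<close> is at most
  \<open>(M + Muu) * (a + c)^2\<close>.\<close>

lemma regular_coefficient_expansion:
  assumes reg: "regular_coefficient T U M Muu \<phi>" and "convex U" "M \<ge> 0" "Muu \<ge> 0"
  shows "\<exists>\<phi>x \<phi>u. uniform_expansion T U \<phi> \<phi>x \<phi>u (M + Muu)"
proof -
  obtain \<phi>' \<phi>'' where reg': "\<forall>t\<in>{0..T}.
        C2_on (UNIV \<times> U) (\<lambda>(x, u). \<phi> t x u) (\<phi>' t) (\<phi>'' t) \<and>
        (\<forall>x x'. \<forall>u\<in>U. \<forall>u'\<in>U.
           onorm (\<lambda>\<xi>. blinfun_apply (\<phi>' t (x, u)) (\<xi>, 0) - blinfun_apply (\<phi>' t (x', u')) (\<xi>, 0))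
             \<le> M * (norm (x - x') + norm (u - u'))) \<and>
        (\<forall>x. \<forall>u\<in>U. \<forall>v w.
           norm (blinfun_apply (blinfun_apply (\<phi>'' t (x, u)) (0, v)) (0, w)) \<le> Muu * norm v * norm w)"
    using reg unfolding regular_coefficient_def by (elim conjE exE)
  have C2: "C2_on (UNIV \<times> U) (\<lambda>(x, u). \<phi> t x u) (\<phi>' t) (\<phi>'' t)" if "t \<in> {0..T}" for t
    using reg' that by simp
  have lip: "onorm (\<lambda>\<xi>. blinfun_apply (\<phi>' t (x, u)) (\<xi>, 0) - blinfun_apply (\<phi>' t (x', u')) (\<xi>, 0))
        \<le> M * (norm (x - x') + norm (u - u'))" if "t \<in> {0..T}" "u \<in> U" "u' \<in> U" for t x x' u u'
    using reg' that by simp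
  have uu: "norm (blinfun_apply (blinfun_apply (\<phi>'' t (x, u)) (0, v)) (0, w)) \<le> Muu * norm v * norm w"
    if "t \<in> {0..T}" "u \<in> U" for t x u v w
    using reg' that by simp
  define \<phi>x where "\<phi>x t x u \<xi> = blinfun_apply (\<phi>' t (x, u)) (\<xi>, 0)" for t x u \<xi>
  define \<phi>u where "\<phi>u t x u w = blinfun_apply (\<phi>' t (x, u)) (0, w)" for t x u w
  have der: "((\<lambda>(x, u). \<phi> t x u) has_derivative blinfun_apply (\<phi>' t (x, u))) (at (x, u) within UNIV \<times> U)"
    and der2: "(\<phi>' t has_derivative blinfun_apply (\<phi>'' t (x, u))) (at (x, u) within UNIV \<times> U)"
    if "t \<in> {0..T}" "u \<in> U" for t x u
    using C2[OF that(1)] that(2) unfolding C2_on_def by auto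
  have dx: "((\<lambda>y. \<phi> t y u) has_derivative \<phi>x t x u) (at x)" if "t \<in> {0..T}" "u \<in> U" for t x u
  proof -
    have pair: "((\<lambda>y. (y, u)) has_derivative (\<lambda>\<xi>. (\<xi>, 0))) (at x)"
      by (intro has_derivative_Pair has_derivative_ident has_derivative_const)
    have "range (\<lambda>y. (y, u)) \<subseteq> UNIV \<times> U"
      using that(2) by auto
    from has_derivative_in_compose[OF pair has_derivative_subset[OF der[OF that] this]]
    show ?thesis
      by (simp add: \<phi>x_def[abs_def])
  qed
  have du: "(\<phi> t x has_derivative \<phi>u t x u) (at u within U)" if "t \<in> {0..T}" "u \<in> U" for t x u
  proof -
    have pair: "((\<lambda>v. (x, v)) has_derivative (\<lambda>w. (0, w))) (at u within U)"
      by (intro has_derivative_Pair has_derivative_ident has_derivative_const)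
    have "(\<lambda>v. (x, v)) ` U \<subseteq> UNIV \<times> U"
      by auto
    from has_derivative_in_compose[OF pair has_derivative_subset[OF der[OF that] this]]
    show ?thesis
      by (simp add: \<phi>u_def[abs_def])
  qed
  have expx: "norm (\<phi> t x' u - \<phi> t x u - \<phi>x t x u (x' - x)) \<le> M * (norm (x' - x))\<^sup>2"
    if "t \<in> {0..T}" "u \<in> U" for t x x' u
  proof -
    have "norm (\<phi> t x' u - \<phi> t x u - \<phi>x t x u (x' - x)) \<le> norm (x' - x) * (M * norm (x' - x))"
    proof (rule differentiable_bound_linearization[where S = "closed_segment x x'"])
      fix s :: real assume "s \<in> {0..1}"
      then show "x + s *\<^sub>R (x' - x) \<in> closed_segment x x'"
        by (auto simp: in_segment algebra_simps)
    next
      fix y assume y: "y \<in> closed_segment x x'"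
      show "((\<lambda>y. \<phi> t y u) has_derivative \<phi>x t y u) (at y within closed_segment x x')"
        using dx[OF that] has_derivative_at_withinI by blast
      have "onorm (\<phi>x t y u - \<phi>x t x u) \<le> M * (norm (y - x) + norm (u - u))"
        using lip[OF that that(2), of y x] by (simp add: \<phi>x_def fun_diff_def)
      also have "\<dots> \<le> M * norm (x' - x)"
        using segment_bound(1)[OF y] \<open>M \<ge> 0\<close> by (auto intro: mult_left_mono)
      finally show "onorm (\<phi>x t y u - \<phi>x t x u) \<le> M * norm (x' - x)" .
    qed auto
    then show ?thesis
      by (simp add: power2_eq_square mult_ac)
  qed
  have lipx: "norm (\<phi>x t x u' \<xi> - \<phi>x t x u \<xi>) \<le> M * norm (u' - u) * norm \<xi>"
    if "t \<in> {0..T}" "u \<in> U" "u' \<in> U" for t x u u' \<xi>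
  proof -
    have "bounded_linear (\<lambda>\<xi>. \<phi>x t x u' \<xi> - \<phi>x t x u \<xi>)"
      using dx that by (intro bounded_linear_sub has_derivative_bounded_linear) blast+
    then have "norm (\<phi>x t x u' \<xi> - \<phi>x t x u \<xi>) \<le> onorm (\<lambda>\<xi>. \<phi>x t x u' \<xi> - \<phi>x t x u \<xi>) * norm \<xi>"
      by (rule onorm)
    also have "\<dots> \<le> M * norm (u' - u) * norm \<xi>"
      using lip[OF that(1,3,2), of x x] by (intro mult_right_mono) (auto simp: \<phi>x_def)
    finally show ?thesis .
  qed
  have expu: "norm (\<phi> t x u' - \<phi> t x u - \<phi>u t x u (u' - u)) \<le> Muu * (norm (u' - u))\<^sup>2"
    if "t \<in> {0..T}" "u \<in> U" "u' \<in> U" for t x u u'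
  proof -
    have inU: "u + e *\<^sub>R (u' - u) \<in> U" if "e \<in> {0..1}" for e
      using convex_alt[of U] \<open>convex U\<close> \<open>u \<in> U\<close> \<open>u' \<in> U\<close> that by (fastforce simp: algebra_simps)
    have d1: "((\<lambda>e. \<phi> t x (u + e *\<^sub>R (u' - u))) has_vector_derivative \<phi>u t x (u + e *\<^sub>R (u' - u)) (u' - u))
        (at e within {0..1})" if "e \<in> {0..1}" for e
      by (rule has_vector_derivative_along_segment[OF \<open>convex U\<close> \<open>u \<in> U\<close> \<open>u' \<in> U\<close> that
            du[OF \<open>t \<in> {0..T}\<close> inU[OF that]]])
    \<comment> \<open>With \<open>x\<close> frozen the segment moves only in the direction
      \<open>(0, u' - u)\<close>, so differentiating again involves exactly the block of the second
      derivative that \<open>Muu\<close> bounds.\<close>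
    have d2: "((\<lambda>e. \<phi>u t x (u + e *\<^sub>R (u' - u)) (u' - u)) has_derivative
        (\<lambda>s. s *\<^sub>R blinfun_apply (blinfun_apply (\<phi>'' t (x, u + e *\<^sub>R (u' - u))) (0, u' - u)) (0, u' - u)))
        (at e within {0..1})" if e: "e \<in> {0..1}" for e
    proof -
      have "((\<lambda>e. \<phi>' t ((x, u) + e *\<^sub>R ((x, u') - (x, u)))) has_vector_derivative
          blinfun_apply (\<phi>'' t (x, u + e *\<^sub>R (u' - u))) ((x, u') - (x, u))) (at e within {0..1})"
        using e inU[OF e] \<open>u \<in> U\<close> \<open>u' \<in> U\<close> \<open>convex U\<close> der2[OF \<open>t \<in> {0..T}\<close> inU[OF e], of x]
        by (intro has_vector_derivative_along_segment[where S = "UNIV \<times> U"]) (auto intro: convex_Times)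
      then have "((\<lambda>e. \<phi>' t (x, u + e *\<^sub>R (u' - u))) has_derivative
          (\<lambda>s. s *\<^sub>R blinfun_apply (\<phi>'' t (x, u + e *\<^sub>R (u' - u))) (0, u' - u))) (at e within {0..1})"
        by (simp add: has_vector_derivative_def)
      from bounded_linear.has_derivative[OF bounded_linear_apply_blinfun this, of "(0, u' - u)"]
      show ?thesis
        by (simp add: \<phi>u_def blinfun.scaleR_left)
    qed
    have "norm (\<phi>u t x (u + e *\<^sub>R (u' - u)) (u' - u) - \<phi>u t x (u + 0 *\<^sub>R (u' - u)) (u' - u))
        \<le> Muu * (norm (u' - u))\<^sup>2" if e: "e \<in> {0..1}" for e
    proof -
      have "norm (\<phi>u t x (u + e *\<^sub>R (u' - u)) (u' - u) - \<phi>u t x (u + 0 *\<^sub>R (u' - u)) (u' - u))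
          \<le> Muu * norm (u' - u) * norm (u' - u) * norm (e - 0)"
      proof (rule differentiable_bound[OF _ d2])
        fix r :: real assume "r \<in> {0..1}"
        then show "onorm (\<lambda>s. s *\<^sub>R blinfun_apply (blinfun_apply (\<phi>'' t (x, u + r *\<^sub>R (u' - u))) (0, u' - u)) (0, u' - u))
            \<le> Muu * norm (u' - u) * norm (u' - u)"
          using uu[OF \<open>t \<in> {0..T}\<close> inU]
          by (intro onorm_le) (simp add: mult.commute mult_left_mono)
      qed (use e in auto)
      also have "\<dots> \<le> Muu * norm (u' - u) * norm (u' - u) * 1"
        using e \<open>Muu \<ge> 0\<close> by (intro mult_left_mono) auto
      finally show ?thesis
        by (simp add: power2_eq_square mult_ac)
    qed
    \<comment> \<open>Linearizing the path at \<open>0\<close> and evaluating it at \<open>1\<close>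
      gives the quadratic remainder; the mean value bound yields \<open>Muu\<close> in place of
      Taylor's \<open>Muu / 2\<close>.\<close>
    then have "norm (\<phi> t x (u + 1 *\<^sub>R (u' - u)) - \<phi> t x (u + 0 *\<^sub>R (u' - u)) -
        (1 - 0) *\<^sub>R \<phi>u t x (u + 0 *\<^sub>R (u' - u)) (u' - u)) \<le> norm (1 - 0 :: real) * (Muu * (norm (u' - u))\<^sup>2)"
      by (intro vector_differentiable_bound_linearization[where S = "{0..1}", OF d1])
         (auto simp: closed_segment_eq_real_ivl)
    then show ?thesis
      by simp
  qed
  have "norm (\<phi> t x' u' - \<phi> t x u - \<phi>x t x u (x' - x) - \<phi>u t x u (u' - u))
      \<le> (M + Muu) * (norm (x' - x) + norm (u' - u))\<^sup>2"
    if "t \<in> {0..T}" "u \<in> U" "u' \<in> U" for t x x' u u'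
  proof -
    have "\<phi> t x' u' - \<phi> t x u - \<phi>x t x u (x' - x) - \<phi>u t x u (u' - u)
        = (\<phi> t x' u' - \<phi> t x u' - \<phi>x t x u' (x' - x)) + (\<phi>x t x u' (x' - x) - \<phi>x t x u (x' - x))
          + (\<phi> t x u' - \<phi> t x u - \<phi>u t x u (u' - u))"
      by simp
    also have "norm \<dots> \<le> M * (norm (x' - x))\<^sup>2 + M * norm (u' - u) * norm (x' - x) + Muu * (norm (u' - u))\<^sup>2"
      using that by (intro norm_triangle_le add_mono expx lipx expu)
    also have "\<dots> \<le> (M + Muu) * (norm (x' - x) + norm (u' - u))\<^sup>2"
      using \<open>M \<ge> 0\<close> \<open>Muu \<ge> 0\<close> by (simp add: power2_eq_square algebra_simps)
    finally show ?thesis .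
  qed
  then have "uniform_expansion T U \<phi> \<phi>x \<phi>u (M + Muu)"
    unfolding uniform_expansion_def
    using dx du reg \<open>M \<ge> 0\<close> \<open>Muu \<ge> 0\<close> by (auto simp: regular_coefficient_def)
  then show ?thesis
    by blast
qed

section \<open>Uniform limits and difference quotients along controls\<close>

lemma bounded_on_interval:
  fixes \<phi> :: "real \<Rightarrow> 'a::real_normed_vector"
  assumes "continuous_on {0..T} \<phi>"
  obtains B where "B > 0" "\<And>t. t \<in> {0..T} \<Longrightarrow> norm (\<phi> t) \<le> B"
  using compact_imp_bounded[OF compact_continuous_image[OF assms compact_Icc]]
  unfolding bounded_pos by blast

lemma controls_segment:
  assumes "convex U" "u \<in> controls T U" "v \<in> controls T U" "e \<in> {0..1}"
  shows "(\<lambda>t. u t + e *\<^sub>R (v t - u t)) \<in> controls T U"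
proof -
  have "u t + e *\<^sub>R (v t - u t) \<in> U" if "t \<in> {0..T}" for t
  proof -
    have "u t + e *\<^sub>R (v t - u t) = (1 - e) *\<^sub>R u t + e *\<^sub>R v t"
      by (simp add: algebra_simps)
    also have "\<dots> \<in> U"
      using assms that by (intro convexD_alt) (auto simp: controls_def)
    finally show ?thesis .
  qed
  then show ?thesis
    using assms(2,3) by (auto simp: controls_def intro!: continuous_intros)
qed

lemma uniform_limit_at_right_0I:
  fixes q :: "real \<Rightarrow> 'a \<Rightarrow> 'b::real_normed_vector"
  assumes "\<And>e t. e \<in> {0<..<1} \<Longrightarrow> t \<in> S \<Longrightarrow> norm (q e t - l t) \<le> e * B"
  shows "uniform_limit S q l (at_right 0)"
proof (rule uniform_limitI)
  fix \<eta> :: real assume "\<eta> > 0"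
  have "((\<lambda>e. e * B) \<longlongrightarrow> 0 * B) (at_right 0)"
    by (intro tendsto_intros)
  then have "\<forall>\<^sub>F e in at_right 0. e * B < \<eta>"
    using \<open>\<eta> > 0\<close> by (simp add: order_tendsto_iff)
  moreover have "\<forall>\<^sub>F e in at_right (0::real). e \<in> {0<..<1}"
    by (rule eventually_at_rightI[where b = 1]) auto
  ultimately show "\<forall>\<^sub>F e in at_right 0. \<forall>t\<in>S. dist (q e t) (l t) < \<eta>"
    by eventually_elim (use assms in \<open>force simp: dist_norm\<close>)
qed

lemma uniform_limit_integral_tendsto:
  fixes q :: "'i \<Rightarrow> real \<Rightarrow> 'a::euclidean_space"
  assumes lim: "uniform_limit {a..b} q l F" and "a \<le> b"
    and q: "\<forall>\<^sub>F e in F. continuous_on {a..b} (q e)" and l: "continuous_on {a..b} l"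
  shows "((\<lambda>e. integral {a..b} (q e)) \<longlongrightarrow> integral {a..b} l) F"
proof (rule tendstoI)
  fix \<eta> :: real assume "\<eta> > 0"
  \<comment> \<open>The summand 1 covers \<open>a = b\<close> and makes the final estimate
    strict.\<close>
  define \<delta> where "\<delta> = \<eta> / (b - a + 1)"
  have "\<delta> > 0"
    using \<open>a \<le> b\<close> \<open>\<eta> > 0\<close> by (simp add: \<delta>_def)
  with lim have "\<forall>\<^sub>F e in F. \<forall>t\<in>{a..b}. dist (q e t) (l t) < \<delta>"
    by (rule uniform_limitD)
  with q show "\<forall>\<^sub>F e in F. dist (integral {a..b} (q e)) (integral {a..b} l) < \<eta>"
  proof eventually_elim
    case (elim e)
    have "dist (integral {a..b} (q e)) (integral {a..b} l) = norm (integral {a..b} (\<lambda>t. q e t - l t))"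
      using elim(1) l by (simp add: dist_norm integral_diff integrable_continuous_real)
    also have "\<dots> \<le> \<delta> * (b - a)"
      using elim l \<open>a \<le> b\<close>
      by (intro integral_bound continuous_intros) (auto simp: dist_norm less_imp_le)
    also have "\<dots> < \<delta> * (b - a + 1)"
      using \<open>\<delta> > 0\<close> by simp
    also have "\<dots> = \<eta>"
      using \<open>a \<le> b\<close> by (simp add: \<delta>_def)
    finally show ?case .
  qed
qed

text \<open>Without a Lipschitz bound on the gradient of \<open>h\<close> there is no rate in
  \<open>e\<close>. Instead the slope along the segments is continuous in \<open>(t, e)\<close> on a
  compact rectangle, hence uniformly continuous, and the mean value bound carries its small
  oscillation over to the quotient.\<close>

lemma uniform_limit_difference_quotient:
  fixes h :: "'u::euclidean_space \<Rightarrow> real"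
  assumes "convex U" and u: "u \<in> controls T U" and v: "v \<in> controls T U"
    and h': "\<And>z. z \<in> U \<Longrightarrow> (h has_derivative (\<lambda>w. h' z \<bullet> w)) (at z within U)"
    and h'c: "continuous_on U h'"
  shows "uniform_limit {0..T} (\<lambda>e t. (h (u t + e *\<^sub>R (v t - u t)) - h (u t)) / e)
    (\<lambda>t. h' (u t) \<bullet> (v t - u t)) (at_right 0)"
proof (rule uniform_limitI)
  fix \<eta> :: real assume "\<eta> > 0"
  let ?z = "\<lambda>t e. u t + e *\<^sub>R (v t - u t)"
  let ?k = "\<lambda>(t, e). h' (?z t e) \<bullet> (v t - u t)"
  have uv: "continuous_on {0..T} u" "continuous_on {0..T} v"
    "\<And>t. t \<in> {0..T} \<Longrightarrow> u t \<in> U" "\<And>t. t \<in> {0..T} \<Longrightarrow> v t \<in> U"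
    using u v by (auto simp: controls_def)
  have z: "?z t e \<in> U" if "t \<in> {0..T}" "e \<in> {0..1}" for t e
    using controls_segment[OF \<open>convex U\<close> u v that(2)] that(1) by (auto simp: controls_def)
  have uv2: "continuous_on ({0..T} \<times> {0..1::real}) (\<lambda>a. u (fst a))"
    "continuous_on ({0..T} \<times> {0..1::real}) (\<lambda>a. v (fst a))"
    by (auto intro!: continuous_on_compose2[OF uv(1)] continuous_on_compose2[OF uv(2)] continuous_intros)
  have "continuous_on ({0..T} \<times> {0..1}) ?k"
    unfolding case_prod_beta
    by (intro continuous_intros uv2 continuous_on_compose2[OF h'c]) (use z in auto)
  then have "uniformly_continuous_on ({0..T} \<times> {0..1}) ?k"
    by (intro compact_uniformly_continuous compact_Times) auto
  then obtain \<delta> where "\<delta> > 0" and \<delta>: "\<And>a a'. a \<in> {0..T} \<times> {0..1} \<Longrightarrow> a' \<in> {0..T} \<times> {0..1} \<Longrightarrow>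
      dist a' a < \<delta> \<Longrightarrow> dist (?k a') (?k a) < \<eta> / 2"
    using \<open>\<eta> > 0\<close> unfolding uniformly_continuous_on_def by (meson half_gt_zero)
  have "dist ((h (?z t e) - h (u t)) / e) (h' (u t) \<bullet> (v t - u t)) < \<eta>"
    if e: "e \<in> {0<..<min \<delta> 1}" and t: "t \<in> {0..T}" for e t
  proof -
    have "norm (h (?z t e) - h (?z t 0) - (e - 0) *\<^sub>R (h' (?z t 0) \<bullet> (v t - u t)))
        \<le> norm (e - 0) * (\<eta> / 2)"
    proof (rule vector_differentiable_bound_linearization[where S = "{0..e}"
          and f' = "\<lambda>r. h' (?z t r) \<bullet> (v t - u t)"])
      fix r assume r: "r \<in> {0..e}"
      then have r1: "r \<in> {0..1}"
        using e by auto
      show "((\<lambda>r. h (?z t r)) has_vector_derivative h' (?z t r) \<bullet> (v t - u t)) (at r within {0..e})"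
        using has_vector_derivative_along_segment[OF \<open>convex U\<close> uv(3,4)[OF t] r1 h'[OF z[OF t r1]]] e
        by (rule_tac has_vector_derivative_within_subset) auto
      show "norm (h' (?z t r) \<bullet> (v t - u t) - h' (?z t 0) \<bullet> (v t - u t)) \<le> \<eta> / 2"
        using \<delta>[of "(t, 0)" "(t, r)"] t r e by (auto simp: dist_norm norm_Pair)
    qed (use e in \<open>auto simp: closed_segment_eq_real_ivl\<close>)
    then have "\<bar>h (?z t e) - h (u t) - e * (h' (u t) \<bullet> (v t - u t))\<bar> \<le> e * (\<eta> / 2)"
      using e by simp
    moreover have "h (?z t e) - h (u t) - e * (h' (u t) \<bullet> (v t - u t))
        = e * ((h (?z t e) - h (u t)) / e - h' (u t) \<bullet> (v t - u t))"
      using e by (simp add: field_simps)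
    ultimately have "e * \<bar>(h (?z t e) - h (u t)) / e - h' (u t) \<bullet> (v t - u t)\<bar> \<le> e * (\<eta> / 2)"
      using e by (simp only: abs_mult) auto
    then have "\<bar>(h (?z t e) - h (u t)) / e - h' (u t) \<bullet> (v t - u t)\<bar> \<le> \<eta> / 2"
      using e by simp
    then show ?thesis
      using \<open>\<eta> > 0\<close> by (simp add: dist_real_def)
  qed
  then show "\<forall>\<^sub>F e in at_right 0. \<forall>t\<in>{0..T}.
      dist ((h (?z t e) - h (u t)) / e) (h' (u t) \<bullet> (v t - u t)) < \<eta>"
    using \<open>\<delta> > 0\<close> by (intro eventually_at_rightI[where b = "min \<delta> 1"]) auto
qed

text \<open>The quotients \<open>q e\<close> are continuous in time because \<open>\<phi>\<close> is
  jointly continuous, and dividing the quadratic remainder by \<open>e\<close> leaves an error of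
  order \<open>e\<close>, uniformly in time. The directional derivative is thus a uniform limit of
  continuous functions.\<close>

lemma uniform_expansion_derivative_continuous:
  assumes exp: "uniform_expansion T U \<phi> \<phi>x \<phi>u C" and "convex U"
    and x: "continuous_on {0..T} x" and \<xi>: "continuous_on {0..T} \<xi>"
    and u: "u \<in> controls T U" and v: "v \<in> controls T U"
  shows "continuous_on {0..T} (\<lambda>t. \<phi>x t (x t) (u t) (\<xi> t) + \<phi>u t (x t) (u t) (v t - u t))"
    (is "continuous_on _ ?l")
proof -
  define q where "q e t = (\<phi> t (x t + e *\<^sub>R \<xi> t) (u t + e *\<^sub>R (v t - u t)) - \<phi> t (x t) (u t)) /\<^sub>R e" for e t
  note C = uniform_expansionD(1)[OF exp] and cont = uniform_expansionD(2)[OF exp]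
  have uv: "continuous_on {0..T} u" "continuous_on {0..T} v" "\<And>t. t \<in> {0..T} \<Longrightarrow> u t \<in> U"
    using u v by (auto simp: controls_def)
  have qc: "continuous_on {0..T} (q e)" if "e \<in> {0<..<1}" for e
    unfolding q_def using that
    by (intro continuous_intros continuous_on_paths[OF cont] controls_segment u v x \<xi> \<open>convex U\<close>) auto
  obtain B where "B > 0" and B: "\<And>t. t \<in> {0..T} \<Longrightarrow> norm (norm (\<xi> t) + norm (v t - u t)) \<le> B"
    by (rule bounded_on_interval[of T "\<lambda>t. norm (\<xi> t) + norm (v t - u t)"])
       (auto intro!: continuous_intros \<xi> uv)
  have err: "norm (q e t - ?l t) \<le> e * (C * B\<^sup>2)" if e: "e \<in> {0<..<1}" and t: "t \<in> {0..T}" for e t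
  proof -
    let ?x = "x t + e *\<^sub>R \<xi> t" and ?u = "u t + e *\<^sub>R (v t - u t)"
    have "?u \<in> U"
      using controls_segment[OF \<open>convex U\<close> u v, of e] e t by (auto simp: controls_def)
    moreover have lin: "linear (\<phi>x t (x t) (u t))" "linear (\<phi>u t (x t) (u t))"
      using uniform_expansionD(6,7)[OF exp t uv(3)[OF t]] by auto
    ultimately have "norm (\<phi> t ?x ?u - \<phi> t (x t) (u t) - \<phi>x t (x t) (u t) (?x - x t) - \<phi>u t (x t) (u t) (?u - u t))
        \<le> C * (norm (?x - x t) + norm (?u - u t))\<^sup>2"
      using uniform_expansionD(5)[OF exp t uv(3)[OF t]] by blast
    also have "norm (?x - x t) + norm (?u - u t) = e * (norm (\<xi> t) + norm (v t - u t))"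
      using e by (simp add: distrib_left)
    also have "\<phi> t ?x ?u - \<phi> t (x t) (u t) - \<phi>x t (x t) (u t) (?x - x t) - \<phi>u t (x t) (u t) (?u - u t)
        = e *\<^sub>R (q e t - ?l t)"
    proof -
      have "\<phi>x t (x t) (u t) (?x - x t) = e *\<^sub>R \<phi>x t (x t) (u t) (\<xi> t)"
        and "\<phi>u t (x t) (u t) (?u - u t) = e *\<^sub>R \<phi>u t (x t) (u t) (v t - u t)"
        using lin by (simp_all add: linear_scale)
      then show ?thesis
        using e by (simp only: q_def) (simp add: algebra_simps)
    qed
    also have "C * (e * (norm (\<xi> t) + norm (v t - u t)))\<^sup>2 \<le> C * (e * B)\<^sup>2"
      using B[OF t] e C by (intro mult_left_mono power_mono) auto
    finally have "e * norm (q e t - ?l t) \<le> e * (e * (C * B\<^sup>2))"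
      using e by (simp add: power2_eq_square mult_ac)
    then show ?thesis
      using e by (simp del: mult.assoc)
  qed
  then have "uniform_limit {0..T} q ?l (at_right 0)"
    by (rule uniform_limit_at_right_0I)
  moreover have "\<forall>\<^sub>F e in at_right 0. continuous_on {0..T} (q e)"
    by (rule eventually_at_rightI[where b = 1]) (auto intro: qc)
  ultimately show ?thesis
    by (intro uniform_limit_theorem[where F = "at_right 0"]) auto
qed

section \<open>Maximizers of strongly concave functions\<close>

text \<open>
  A gradient within a set of empty interior is not unique, so a field of functionals is represented
  on an orthonormal basis of the span of the feasible directions.
\<close>

lemma continuous_functional_representation:
  fixes c :: "real \<Rightarrow> 'u::euclidean_space \<Rightarrow> real"
  assumes lin: "\<And>t. t \<in> S \<Longrightarrow> linear (c t)" and u: "\<And>t. t \<in> S \<Longrightarrow> u t \<in> U"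
    and cont: "\<And>v. v \<in> U \<Longrightarrow> continuous_on S (\<lambda>t. c t (v - u t))"
  obtains a where "continuous_on S a"
    and "\<And>t v w. t \<in> S \<Longrightarrow> v \<in> U \<Longrightarrow> w \<in> U \<Longrightarrow> a t \<bullet> (v - w) = c t (v - w)"
proof -
  let ?D = "{v - w |v w. v \<in> U \<and> w \<in> U}"
  \<comment> \<open>The hypothesis concerns directions \<open>v - u t\<close> that move with
    \<open>t\<close>, whereas basis vectors are fixed. Subtracting two such directions cancels
    \<open>u t\<close>, and linearity extends continuity to the span.\<close>
  have cD: "continuous_on S (\<lambda>t. c t d)" if "d \<in> span ?D" for d
    using that
  proof (induction rule: span_induct_alt)
    case base
    have "continuous_on S (\<lambda>t. 0 :: real)"
      by simp
    then show ?case
      by (rule continuous_on_eq) (simp add: lin linear_0)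
  next
    case (step r d e)
    then obtain v w where d: "d = v - w" "v \<in> U" "w \<in> U"
      by auto
    have "continuous_on S (\<lambda>t. r * (c t (v - u t) - c t (w - u t)) + c t e)"
      by (intro continuous_intros cont step d)
    then show ?case
      by (rule continuous_on_eq) (simp add: lin linear_add linear_scale linear_diff d)
  qed
  obtain B where B: "B \<subseteq> span ?D" "pairwise orthogonal B" "\<And>x. x \<in> B \<Longrightarrow> norm x = 1"
    "independent B" "span B = span ?D"
    by (rule orthonormal_basis_subspace[OF subspace_span[of ?D]]) blast
  have "finite B"
    using B(4) by (rule finiteI_independent)
  define a where "a t = (\<Sum>i\<in>B. c t i *\<^sub>R i)" for t
  show thesis
  proof
    show "continuous_on S a"
      unfolding a_def using B(1) by (intro continuous_intros cD) auto
    fix t v w assume t: "t \<in> S" and vw: "v \<in> U" "w \<in> U"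
    have "v - w \<in> span B"
      unfolding B(5) using vw by (intro span_base) auto
    then show "a t \<bullet> (v - w) = c t (v - w)"
    proof (induction rule: span_induct_alt)
      case base
      then show ?case using t by (simp add: lin linear_0)
    next
      case (step r i e)
      have "a t \<bullet> i = (\<Sum>j\<in>B. if j = i then c t j else 0)"
        unfolding a_def inner_sum_left
        using B(2) B(3)[OF step(1)] step(1)
        by (intro sum.cong) (auto simp: pairwise_def orthogonal_def dot_square_norm)
      then have "a t \<bullet> i = c t i"
        using \<open>finite B\<close> step(1) by simp
      then show ?case
        using step t by (simp add: lin linear_add linear_scale inner_add_right)
    qed
  qed
qed

text \<open>Testing optimality against the midpoint \<open>m\<close> replaces a first-order
  condition. The displacements \<open>v - m\<close> and \<open>w - m\<close> are opposite, so the
  gradient terms at \<open>m\<close> cancel when the two Bregman bounds are added; each contributes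
  \<open>\<sigma> / 8\<close>, which gives \<open>\<sigma> / 4\<close>.\<close>

lemma strongly_concave_arg_max_gap:
  fixes h :: "'u::euclidean_space \<Rightarrow> real"
  assumes "convex U" "lam \<ge> 0"
    and strong: "\<And>v w. v \<in> U \<Longrightarrow> w \<in> U \<Longrightarrow> bregman U h v w \<ge> \<sigma> / 2 * (norm (v - w))\<^sup>2"
    and w: "w \<in> U" "\<And>v. v \<in> U \<Longrightarrow> a \<bullet> v - lam * h v \<le> a \<bullet> w - lam * h w"
    and v: "v \<in> U"
  shows "lam * \<sigma> / 4 * (norm (v - w))\<^sup>2 \<le> (a \<bullet> w - lam * h w) - (a \<bullet> v - lam * h v)"
proof -
  define m where "m = (1 / 2) *\<^sub>R v + (1 / 2) *\<^sub>R w"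
  have m: "m \<in> U"
    unfolding m_def using \<open>convex U\<close> v w by (intro convexD) auto
  have vm: "v - m = (1 / 2) *\<^sub>R (v - w)" and wm: "w - m = - ((1 / 2) *\<^sub>R (v - w))"
    by (simp_all add: m_def algebra_simps flip: scaleR_add_left)
  have "h v + h w - 2 * h m \<ge> \<sigma> / 4 * (norm (v - w))\<^sup>2"
    using strong[OF v m] strong[OF w(1) m]
    by (simp add: bregman_def vm wm power_mult_distrib power_divide)
  then have "lam * (h v + h w - 2 * h m) \<ge> lam * (\<sigma> / 4 * (norm (v - w))\<^sup>2)"
    using \<open>lam \<ge> 0\<close> by (rule mult_left_mono)
  moreover have "a \<bullet> m = (a \<bullet> v + a \<bullet> w) / 2"
    by (simp add: m_def inner_add_right)
  ultimately show ?thesis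
    using w(2)[OF m] by (simp add: algebra_simps)
qed

text \<open>Adding the gap at \<open>s\<close> tested with \<open>w t\<close> and the gap at
  \<open>t\<close> tested with \<open>w s\<close> cancels every value of \<open>h\<close> and leaves
  \<open>(a s - a t) \<bullet> (w s - w t)\<close>. By Cauchy-Schwarz the maximizer is a Lipschitz
  function of the linear part, with constant \<open>2 / (lam * \<sigma>)\<close>.\<close>

lemma strongly_concave_arg_max_continuous:
  fixes h :: "'u::euclidean_space \<Rightarrow> real" and S :: "'a::metric_space set"
  assumes "convex U" "lam > 0" "\<sigma> > 0"
    and strong: "\<And>v w. v \<in> U \<Longrightarrow> w \<in> U \<Longrightarrow> bregman U h v w \<ge> \<sigma> / 2 * (norm (v - w))\<^sup>2"
    and a: "continuous_on S a"
    and w: "\<And>t. t \<in> S \<Longrightarrow> w t \<in> U"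
      "\<And>t v. t \<in> S \<Longrightarrow> v \<in> U \<Longrightarrow> a t \<bullet> v - lam * h v \<le> a t \<bullet> w t - lam * h (w t)"
  shows "continuous_on S w"
proof -
  have le: "lam * \<sigma> / 2 * dist (w s) (w t) \<le> dist (a s) (a t)" if "s \<in> S" "t \<in> S" for s t
  proof (cases "w s = w t")
    case False
    have "lam * \<sigma> / 4 * (norm (w t - w s))\<^sup>2 + lam * \<sigma> / 4 * (norm (w s - w t))\<^sup>2
        \<le> (a s \<bullet> w s - lam * h (w s)) - (a s \<bullet> w t - lam * h (w t))
          + ((a t \<bullet> w t - lam * h (w t)) - (a t \<bullet> w s - lam * h (w s)))"
      using that assms(1,2) strong w by (intro add_mono strongly_concave_arg_max_gap) auto
    also have "\<dots> = (a s - a t) \<bullet> (w s - w t)"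
      by (simp add: inner_diff_left inner_diff_right)
    also have "\<dots> \<le> dist (a s) (a t) * dist (w s) (w t)"
      by (simp add: dist_norm norm_cauchy_schwarz)
    finally have "lam * \<sigma> / 2 * dist (w s) (w t) * dist (w s) (w t) \<le> dist (a s) (a t) * dist (w s) (w t)"
      by (simp add: dist_norm norm_minus_commute[of "w t"] power2_eq_square mult_ac)
    then show ?thesis
      using False by simp
  qed simp
  show ?thesis
    unfolding continuous_on_iff
  proof (intro ballI allI impI)
    fix t and \<eta> :: real assume "t \<in> S" "\<eta> > 0"
    then have "lam * \<sigma> / 2 * \<eta> > 0"
      using assms by simp
    then obtain \<delta> where "\<delta> > 0" and \<delta>: "\<And>s. s \<in> S \<Longrightarrow> dist s t < \<delta> \<Longrightarrow> dist (a s) (a t) < lam * \<sigma> / 2 * \<eta>"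
      using a \<open>t \<in> S\<close> unfolding continuous_on_iff by metis
    have "dist (w s) (w t) < \<eta>" if "s \<in> S" "dist s t < \<delta>" for s
    proof -
      have "lam * \<sigma> / 2 * dist (w s) (w t) < lam * \<sigma> / 2 * \<eta>"
        using le[OF \<open>s \<in> S\<close> \<open>t \<in> S\<close>] \<delta>[OF that] by simp
      then show ?thesis
        using assms(2,3) by (simp only: mult_less_cancel_left) (auto simp: not_less mult_le_0_iff)
    qed
    then show "\<exists>\<delta>>0. \<forall>s\<in>S. dist s t < \<delta> \<longrightarrow> dist (w s) (w t) < \<eta>"
      using \<open>\<delta> > 0\<close> by blast
  qed
qed

section \<open>Continuity in time of the integrands\<close>

lemma uniform_expansion_partial_derivatives_continuous:
  assumes exp: "uniform_expansion T U \<phi> \<phi>x \<phi>u C" and "convex U"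
    and x: "continuous_on {0..T} x" and u: "u \<in> controls T U"
  shows "continuous_on {0..T} \<xi> \<Longrightarrow> continuous_on {0..T} (\<lambda>t. \<phi>x t (x t) (u t) (\<xi> t))"
    and "v \<in> controls T U \<Longrightarrow> continuous_on {0..T} (\<lambda>t. \<phi>u t (x t) (u t) (v t - u t))"
proof -
  have uU: "u t \<in> U" if "t \<in> {0..T}" for t
    using u that by (auto simp: controls_def)
  \<comment> \<open>The two partial derivatives are separated by the degenerate choices
    \<open>v = u\<close> here and \<open>\<xi> = 0\<close> below.\<close>
  show "continuous_on {0..T} (\<lambda>t. \<phi>x t (x t) (u t) (\<xi> t))" if "continuous_on {0..T} \<xi>"
    by (rule continuous_on_eq[OF uniform_expansion_derivative_continuous[OF exp \<open>convex U\<close> x that u u]])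
       (simp add: uniform_expansionD(7)[OF exp _ uU] linear_0)
  show "continuous_on {0..T} (\<lambda>t. \<phi>u t (x t) (u t) (v t - u t))" if "v \<in> controls T U"
    by (rule continuous_on_eq[OF uniform_expansion_derivative_continuous[OF exp \<open>convex U\<close> x continuous_on_const[of _ 0] u that]])
       (simp add: uniform_expansionD(6)[OF exp _ uU] linear_0)
qed

text \<open>With \<open>p\<close> frozen as a function of time the Hamiltonian becomes a coefficient
  like \<open>b\<close> and \<open>f\<close>, so everything proved for expansions applies to it. The
  constant is uniform in time since a continuous \<open>p\<close> is bounded on
  \<open>{0..T}\<close>.\<close>

lemma uniform_expansion_hamiltonian0:
  assumes b: "uniform_expansion T U b bx bu Cb" and f: "uniform_expansion T U f fx fu Cf"
    and p: "continuous_on {0..T} p"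
  shows "\<exists>C. uniform_expansion T U (\<lambda>t x u. hamiltonian0 b f t x (p t) u)
    (\<lambda>t x u \<xi>. p t \<bullet> bx t x u \<xi> - fx t x u \<xi>) (\<lambda>t x u w. p t \<bullet> bu t x u w - fu t x u w) C"
proof -
  note B = uniform_expansionD[OF b] and F = uniform_expansionD[OF f]
  obtain P where "P > 0" and P: "\<And>t. t \<in> {0..T} \<Longrightarrow> norm (p t) \<le> P"
    using bounded_on_interval[OF p] by blast
  have "norm (hamiltonian0 b f t x' (p t) u' - hamiltonian0 b f t x (p t) u -
        (p t \<bullet> bx t x u (x' - x) - fx t x u (x' - x)) - (p t \<bullet> bu t x u (u' - u) - fu t x u (u' - u)))
      \<le> (P * Cb + Cf) * (norm (x' - x) + norm (u' - u))\<^sup>2"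
    if t: "t \<in> {0..T}" "u \<in> U" "u' \<in> U" for t x x' u u'
  proof -
    let ?rb = "b t x' u' - b t x u - bx t x u (x' - x) - bu t x u (u' - u)"
    let ?rf = "f t x' u' - f t x u - fx t x u (x' - x) - fu t x u (u' - u)"
    have "norm (p t \<bullet> ?rb - ?rf) \<le> norm (p t) * norm ?rb + norm ?rf"
      using norm_triangle_ineq4[of "p t \<bullet> ?rb" ?rf] Cauchy_Schwarz_ineq2[of "p t" ?rb] by simp
    also have "\<dots> \<le> P * (Cb * (norm (x' - x) + norm (u' - u))\<^sup>2) + Cf * (norm (x' - x) + norm (u' - u))\<^sup>2"
      using P[OF t(1)] B(5)[OF t] F(5)[OF t] \<open>P > 0\<close> by (intro add_mono mult_mono) auto
    finally show ?thesis
      by (simp add: hamiltonian0_def algebra_simps)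
  qed
  moreover have "continuous_on ({0..T} \<times> UNIV \<times> U) (\<lambda>(t, x, u). hamiltonian0 b f t x (p t) u)"
  proof -
    have "continuous_on ({0..T} \<times> UNIV \<times> U) (\<lambda>a. p (fst a))"
      by (rule continuous_on_compose2[OF p]) (auto intro!: continuous_intros)
    then show ?thesis
      using B(2) F(2) unfolding hamiltonian0_def case_prod_beta
      by (intro continuous_intros)
  qed
  ultimately have "uniform_expansion T U (\<lambda>t x u. hamiltonian0 b f t x (p t) u)
    (\<lambda>t x u \<xi>. p t \<bullet> bx t x u \<xi> - fx t x u \<xi>) (\<lambda>t x u w. p t \<bullet> bu t x u w - fu t x u w) (P * Cb + Cf)"
    unfolding uniform_expansion_def hamiltonian0_def
    using B(1,3,4) F(1,3,4) \<open>P > 0\<close>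
    by (auto intro!: has_derivative_diff has_derivative_inner_right)
  then show ?thesis
    by blast
qed

text \<open>The vectors chosen by \<open>gradient_within\<close> need not vary continuously, but on
  feasible directions they act like the continuous \<open>h'\<close>, which replaces them.\<close>

lemma path_bregman_integrand_continuous:
  assumes "convex U" "C1_on U h" and u: "u \<in> controls T U" and v: "v \<in> controls T U"
  shows "continuous_on {0..T} (\<lambda>t. bregman U h (v t) (u t))"
proof -
  obtain h' where h': "\<And>z. z \<in> U \<Longrightarrow> (h has_derivative (\<lambda>w. h' z \<bullet> w)) (at z within U)"
    and h'c: "continuous_on U h'"
    using \<open>C1_on U h\<close> by (auto simp: C1_on_def)
  have hc: "continuous_on U h"
    by (rule has_derivative_continuous_on[OF h'])
  have "continuous_on {0..T} (\<lambda>t. h (v t) - h (u t) - h' (u t) \<bullet> (v t - u t))"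
    using u v
    by (intro continuous_intros continuous_on_compose2[OF hc] continuous_on_compose2[OF h'c])
       (auto simp: controls_def)
  moreover have "gradient_within h U (u t) \<bullet> (v t - u t) = h' (u t) \<bullet> (v t - u t)" if "t \<in> {0..T}" for t
    using u v that by (intro gradient_within_inner[OF \<open>convex U\<close> _ _ h']) (auto simp: controls_def)
  ultimately show ?thesis
    unfolding bregman_def by (auto elim: continuous_on_eq)
qed

section \<open>State, adjoint and derivative of the cost\<close>

context control_problem
begin

lemma b_f_expansion:
  obtains bx bu Cb fx fu Cf
  where "uniform_expansion T U b bx bu Cb" "uniform_expansion T U f fx fu Cf"
proof -
  have "M \<ge> 0" "Mbuu \<ge> 0" "Mfuu \<ge> 0"
    using M_pos Mbuu_pos Mfuu_pos by auto
  then show thesis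
    using regular_coefficient_expansion[OF b_regular U_convex] regular_coefficient_expansion[OF f_regular U_convex]
    by (auto intro: that)
qed

lemma b_lipschitz:
  assumes "t \<in> {0..T}" "u \<in> U" "u' \<in> U"
  shows "norm (b t x u - b t x' u') \<le> M * (norm (x - x') + norm (u - u'))"
proof -
  have "\<forall>t\<in>{0..T}. \<forall>x x'. \<forall>u\<in>U. \<forall>u'\<in>U. norm (b t x u - b t x' u') \<le> M * (norm (x - x') + norm (u - u'))"
    using b_regular unfolding regular_coefficient_def by (elim conjE)
  then show ?thesis
    using assms by simp
qed

lemma g_has_derivative: "(g has_derivative (\<lambda>w. gradient g x \<bullet> w)) (at x)"
  using g_C1 by (auto simp: C1_on_def intro: has_derivative_gradient_within)

text \<open>Existence is what makes the choice in \<open>state\<close> meaningful. Inserting the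
  control into \<open>b\<close> leaves a field that is continuous in time and state and
  \<open>M\<close>-Lipschitz in the state.\<close>

lemma is_state_state:
  assumes u: "u \<in> controls T U"
  shows "is_state T x0 b u (state T x0 b u)"
proof -
  have bc: "continuous_on ({0..T} \<times> UNIV \<times> U) (\<lambda>(t, x, u). b t x u)"
    using b_regular unfolding regular_coefficient_def by (elim conjE)
  have uc: "continuous_on ({0..T} \<times> UNIV) (\<lambda>a. u (fst a))"
    by (rule continuous_on_compose2[where g = u and t = "{0..T}"])
       (use u in \<open>auto simp: controls_def intro!: continuous_intros\<close>)
  have "continuous_on ({0..T} \<times> UNIV) (\<lambda>(t, x). b t x (u t))"
    unfolding case_prod_beta
    by (rule continuous_on_compose2[OF bc, where f = "\<lambda>a. (fst a, snd a, u (fst a))", simplified])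
       (use u in \<open>auto simp: controls_def intro!: continuous_intros uc\<close>)
  moreover have "norm (b t x (u t) - b t x' (u t)) \<le> M * norm (x - x')" if "t \<in> {0..T}" for t x x'
  proof -
    have "u t \<in> U"
      using u that by (auto simp: controls_def)
    then show ?thesis
      using b_lipschitz[OF that, of "u t" "u t" x x'] by simp
  qed
  ultimately have "\<exists>x. is_state T x0 b u x"
    unfolding is_state_def by (intro lipschitz_ode_solution_exists[OF T_pos M_pos])
  then show ?thesis
    unfolding state_def by (rule someI_ex)
qed

lemma state_continuous:
  assumes "u \<in> controls T U"
  shows "continuous_on {0..T} (state T x0 b u)"
  using is_state_state[OF assms] unfolding is_state_def
  by (auto intro!: has_vector_derivative_continuous simp: continuous_on_eq_continuous_within)

text \<open>The adjoint equation is affine in \<open>p\<close> with data at the final time.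
  Reversing time turns it into an initial value problem, and continuity in time of the derivatives
  along the path makes its coefficients continuous, hence its Lipschitz constant finite.\<close>

lemma is_costate_costate:
  assumes u: "u \<in> controls T U"
  shows "is_costate T b f g u (state T x0 b u) (costate T x0 b f g u)"
proof -
  define x where "x = state T x0 b u"
  obtain bx bu Cb fx fu Cf
    where b: "uniform_expansion T U b bx bu Cb" and f: "uniform_expansion T U f fx fu Cf"
    by (rule b_f_expansion)
  have xc: "continuous_on {0..T} x"
    unfolding x_def by (rule state_continuous[OF u])
  have uU: "u t \<in> U" if "t \<in> {0..T}" for t
    using u that by (auto simp: controls_def)
  define \<beta> where "\<beta> i t = bx (T - t) (x (T - t)) (u (T - t)) i" for i t
  define \<phi> where "\<phi> i t = fx (T - t) (x (T - t)) (u (T - t)) i" for i t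
  have rev: "continuous_on {0..T} (\<lambda>t. k (T - t))" if "continuous_on {0..T} k" for k :: "real \<Rightarrow> 'z::topological_space"
    by (rule continuous_on_compose2[OF that]) (auto intro!: continuous_intros)
  have \<beta>c: "continuous_on {0..T} (\<beta> i)" and \<phi>c: "continuous_on {0..T} (\<phi> i)" for i
    unfolding \<beta>_def \<phi>_def
    by (intro rev[of "\<lambda>t. bx t (x t) (u t) i"] rev[of "\<lambda>t. fx t (x t) (u t) i"] continuous_on_const
        uniform_expansion_partial_derivatives_continuous[OF b U_convex xc u]
        uniform_expansion_partial_derivatives_continuous[OF f U_convex xc u])+
  \<comment> \<open>The Hamiltonian gradient in coordinates, as an affine function of the adjoint
    value \<open>y\<close>. Its time argument is the reversed one; reversal also removes the minus
    sign of the adjoint equation.\<close>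
  define G where "G t y = (\<Sum>i\<in>Basis. (y \<bullet> \<beta> i t - \<phi> i t) *\<^sub>R i)" for t y
  have grad: "gradient (\<lambda>z. hamiltonian0 b f t z y (u t)) (x t) = G (T - t) y" if t: "t \<in> {0..T}" for t y
  proof (rule euclidean_eqI)
    fix i :: 'x assume i: "i \<in> Basis"
    have "((\<lambda>z. hamiltonian0 b f t z y (u t)) has_derivative
        (\<lambda>\<xi>. y \<bullet> bx t (x t) (u t) \<xi> - fx t (x t) (u t) \<xi>)) (at (x t))"
      unfolding hamiltonian0_def
      by (intro has_derivative_diff has_derivative_inner_right uniform_expansionD(3)[OF b]
          uniform_expansionD(3)[OF f] uU t)
    from gradient_inner[OF this, of i]
    show "gradient (\<lambda>z. hamiltonian0 b f t z y (u t)) (x t) \<bullet> i = G (T - t) y \<bullet> i"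
      using i by (simp add: G_def \<beta>_def \<phi>_def)
  qed
  \<comment> \<open>By Cauchy-Schwarz in each coordinate, \<open>K t\<close> is a Lipschitz constant
    of \<open>G t\<close>.\<close>
  define K where "K t = (\<Sum>i\<in>Basis. norm (\<beta> i t))" for t
  have "continuous_on {0..T} K"
    unfolding K_def by (intro continuous_intros \<beta>c)
  then obtain k where "k > 0" and k: "\<And>t. t \<in> {0..T} \<Longrightarrow> norm (K t) \<le> k"
    using bounded_on_interval by blast
  have "continuous_on ({0..T} \<times> UNIV) (\<lambda>(t, y). G t y)"
    unfolding G_def case_prod_beta
    by (intro continuous_intros continuous_on_compose2[OF \<beta>c] continuous_on_compose2[OF \<phi>c]) auto
  moreover have "norm (G t y - G t z) \<le> k * norm (y - z)" if t: "t \<in> {0..T}" for t y z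
  proof -
    have "G t y - G t z = (\<Sum>i\<in>Basis. ((y - z) \<bullet> \<beta> i t) *\<^sub>R i)"
      unfolding G_def by (simp add: algebra_simps flip: sum_subtractf)
    also have "norm \<dots> \<le> (\<Sum>i\<in>Basis. norm (y - z) * norm (\<beta> i t))"
      by (rule sum_norm_le) (simp add: Cauchy_Schwarz_ineq2)
    also have "\<dots> = norm (y - z) * K t"
      by (simp add: K_def sum_distrib_left)
    also have "\<dots> \<le> norm (y - z) * k"
      using k[OF t] by (intro mult_left_mono) auto
    finally show ?thesis
      by (simp add: mult.commute)
  qed
  ultimately obtain q where q0: "q 0 = - gradient g (x T)"
    and q: "\<And>t. t \<in> {0..T} \<Longrightarrow> (q has_vector_derivative G t (q t)) (at t within {0..T})"
    using lipschitz_ode_solution_exists[OF T_pos \<open>k > 0\<close>, of G "- gradient g (x T)"] by blast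
  have "((\<lambda>t. q (T - t)) has_vector_derivative - G (T - t) (q (T - t))) (at t within {0..T})"
    if t: "t \<in> {0..T}" for t
  proof -
    have "((\<lambda>t. T - t) has_vector_derivative - 1) (at t within {0..T})"
      by (auto intro!: derivative_eq_intros)
    moreover have "(\<lambda>t. T - t) ` {0..T} = {0..T}"
      by (auto simp: image_iff intro: bexI[of _ "T - _"])
    ultimately have "(q \<circ> (\<lambda>t. T - t) has_vector_derivative - 1 *\<^sub>R G (T - t) (q (T - t))) (at t within {0..T})"
      using q[of "T - t"] t by (intro vector_diff_chain_within) auto
    then show ?thesis
      by (simp add: o_def)
  qed
  then have "is_costate T b f g u x (\<lambda>t. q (T - t))"
    unfolding is_costate_def using q0 by (simp add: grad)
  then have "\<exists>p. is_costate T b f g u x p"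
    by blast
  then show ?thesis
    unfolding costate_def x_def by (rule someI_ex)
qed

lemma costate_continuous:
  assumes "u \<in> controls T U"
  shows "continuous_on {0..T} (costate T x0 b f g u)"
  using is_costate_costate[OF assms] unfolding is_costate_def
  by (auto intro!: has_vector_derivative_continuous simp: continuous_on_eq_continuous_within)

lemma g_remainder: "\<bar>g y - g x - gradient g x \<bullet> (y - x)\<bar> \<le> M * (norm (y - x))\<^sup>2"
proof -
  have "norm (g y - g x - gradient g x \<bullet> (y - x)) \<le> norm (y - x) * (M * norm (y - x))"
  proof (rule differentiable_bound_linearization[where S = "closed_segment x y" and f' = "\<lambda>z w. gradient g z \<bullet> w"])
    fix s :: real assume "s \<in> {0..1}"
    then show "x + s *\<^sub>R (y - x) \<in> closed_segment x y"
      by (auto simp: in_segment algebra_simps)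
  next
    fix z assume z: "z \<in> closed_segment x y"
    show "(g has_derivative (\<lambda>w. gradient g z \<bullet> w)) (at z within closed_segment x y)"
      using g_has_derivative has_derivative_at_withinI by blast
    have "onorm ((\<lambda>w. gradient g z \<bullet> w) - (\<lambda>w. gradient g x \<bullet> w)) \<le> norm (gradient g z - gradient g x)"
      by (intro onorm_le)
         (simp add: fun_diff_def Cauchy_Schwarz_ineq2 flip: inner_diff_left)
    also have "\<dots> \<le> M * norm (z - x)"
      using g_bounds[of z x] by simp
    also have "\<dots> \<le> M * norm (y - x)"
      using segment_bound(1)[OF z] M_pos by (intro mult_left_mono) auto
    finally show "onorm ((\<lambda>w. gradient g z \<bullet> w) - (\<lambda>w. gradient g x \<bullet> w)) \<le> M * norm (y - x)" .
  qed auto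
  then show ?thesis
    by (simp add: power2_eq_square mult_ac)
qed

text \<open>Gronwall's bound with the control difference as forcing. Applied to a perturbation
  \<open>e *\<^sub>R (v t - u t)\<close>, it shows that the state moves by order \<open>e\<close>,
  so a quadratic remainder is of order \<open>e^2\<close>.\<close>

lemma state_stability:
  assumes u: "u \<in> controls T U" and v: "v \<in> controls T U"
    and c: "\<And>t. t \<in> {0..T} \<Longrightarrow> norm (v t - u t) \<le> c" and t: "t \<in> {0..T}"
  shows "norm (state T x0 b v t - state T x0 b u t) \<le> 2 * M * T * exp (2 * M * T) * c"
proof -
  note su = is_state_state[OF u, unfolded is_state_def] and sv = is_state_state[OF v, unfolded is_state_def]
  have "c \<ge> 0"
    using order_trans[OF norm_ge_zero c[OF t]] .
  show ?thesis
  proof (rule gronwall_bound[OF _ M_pos \<open>c \<ge> 0\<close> _ _ _ t])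
    fix r assume r: "r \<in> {0..T}"
    show "((\<lambda>t. state T x0 b v t - state T x0 b u t) has_vector_derivative
        b r (state T x0 b v r) (v r) - b r (state T x0 b u r) (u r)) (at r within {0..T})"
      using su sv r by (intro has_vector_derivative_diff) auto
    have "norm (b r (state T x0 b v r) (v r) - b r (state T x0 b u r) (u r))
        \<le> M * (norm (state T x0 b v r - state T x0 b u r) + norm (v r - u r))"
      using u v r by (intro b_lipschitz) (auto simp: controls_def)
    also have "\<dots> \<le> M * (norm (state T x0 b v r - state T x0 b u r) + c)"
      using c[OF r] M_pos by simp
    finally show "norm (b r (state T x0 b v r) (v r) - b r (state T x0 b u r) (u r))
        \<le> M * (norm (state T x0 b v r - state T x0 b u r) + c)" .
  qed (use su sv T_pos in auto)
qed

text \<open>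
  Integrating the derivative of \<open>p \<bullet> (y - x)\<close> trades the linear part of the terminal cost for
  Hamiltonian terms, so that no linearized state equation is needed.
\<close>

lemma cost_difference:
  assumes u: "u \<in> controls T U" and v: "v \<in> controls T U"
    and b: "uniform_expansion T U b bx bu Cb" and f: "uniform_expansion T U f fx fu Cf"
    and hc: "continuous_on U h"
  defines "x \<equiv> state T x0 b u" and "p \<equiv> costate T x0 b f g u" and "y \<equiv> state T x0 b v"
  shows "cost T x0 \<tau> b f g h v - cost T x0 \<tau> b f g h u
    = integral {0..T} (\<lambda>t. \<tau> * (h (v t) - h (u t)) - (hamiltonian0 b f t (y t) (p t) (v t) -
        hamiltonian0 b f t (x t) (p t) (u t) - (p t \<bullet> bx t (x t) (u t) (y t - x t) - fx t (x t) (u t) (y t - x t))))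
      + (g (y T) - g (x T) - gradient g (x T) \<bullet> (y T - x T))"
proof -
  have uU: "u t \<in> U" and vU: "v t \<in> U" if "t \<in> {0..T}" for t
    using u v that by (auto simp: controls_def)
  have xc: "continuous_on {0..T} x" and yc: "continuous_on {0..T} y"
    unfolding x_def y_def by (intro state_continuous u v)+
  have x: "x 0 = x0" "\<And>t. t \<in> {0..T} \<Longrightarrow> (x has_vector_derivative b t (x t) (u t)) (at t within {0..T})"
    using is_state_state[OF u] by (auto simp: is_state_def x_def)
  have y: "y 0 = x0" "\<And>t. t \<in> {0..T} \<Longrightarrow> (y has_vector_derivative b t (y t) (v t)) (at t within {0..T})"
    using is_state_state[OF v] by (auto simp: is_state_def y_def)
  define p' where "p' t = - gradient (\<lambda>z. hamiltonian0 b f t z (p t) (u t)) (x t)" for t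
  have p: "p T = - gradient g (x T)" "\<And>t. t \<in> {0..T} \<Longrightarrow> (p has_vector_derivative p' t) (at t within {0..T})"
    using is_costate_costate[OF u] by (auto simp: is_costate_def x_def p_def p'_def)
  have p': "p' t \<bullet> \<xi> = - (p t \<bullet> bx t (x t) (u t) \<xi> - fx t (x t) (u t) \<xi>)" if t: "t \<in> {0..T}" for t \<xi>
  proof -
    have "((\<lambda>z. hamiltonian0 b f t z (p t) (u t)) has_derivative
        (\<lambda>\<xi>. p t \<bullet> bx t (x t) (u t) \<xi> - fx t (x t) (u t) \<xi>)) (at (x t))"
      unfolding hamiltonian0_def
      by (intro has_derivative_diff has_derivative_inner_right uniform_expansionD(3)[OF b]
          uniform_expansionD(3)[OF f] uU t)
    from gradient_inner[OF this] show ?thesis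
      by (simp add: p'_def)
  qed
  have cost: "(\<lambda>t. f t (state T x0 b w t) (w t) + \<tau> * h (w t)) integrable_on {0..T}" if "w \<in> controls T U" for w
    using that
    by (intro integrable_continuous_real continuous_intros continuous_on_compose2[OF hc]
        continuous_on_paths[OF uniform_expansionD(2)[OF f]] state_continuous)
       (auto simp: controls_def)
  \<comment> \<open>Product rule for \<open>p \<bullet> (y - x)\<close>. The boundary term at
    \<open>0\<close> vanishes since both states start at \<open>x0\<close>; the one at
    \<open>T\<close> is the linearized terminal cost because of the final value of
    \<open>p\<close>.\<close>
  have "((\<lambda>t. p t \<bullet> (b t (y t) (v t) - b t (x t) (u t)) + p' t \<bullet> (y t - x t)) has_integral
      p T \<bullet> (y T - x T) - p 0 \<bullet> (y 0 - x 0)) {0..T}"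
    using T_pos
    by (intro fundamental_theorem_of_calculus bounded_bilinear.has_vector_derivative[OF bounded_bilinear_inner]
        has_vector_derivative_diff x y p) auto
  then have adj: "((\<lambda>t. p t \<bullet> (b t (y t) (v t) - b t (x t) (u t)) + p' t \<bullet> (y t - x t)) has_integral
      - (gradient g (x T) \<bullet> (y T - x T))) {0..T}"
    by (simp add: x(1) y(1) p(1))
  have "((\<lambda>t. (f t (y t) (v t) + \<tau> * h (v t)) - (f t (x t) (u t) + \<tau> * h (u t))
        - (p t \<bullet> (b t (y t) (v t) - b t (x t) (u t)) + p' t \<bullet> (y t - x t))) has_integral
      integral {0..T} (\<lambda>t. f t (y t) (v t) + \<tau> * h (v t)) - integral {0..T} (\<lambda>t. f t (x t) (u t) + \<tau> * h (u t))
        - - (gradient g (x T) \<bullet> (y T - x T))) {0..T}"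
    using cost[OF u] cost[OF v] unfolding x_def[symmetric] y_def[symmetric]
    by (intro has_integral_diff adj integrable_integral)
  then have "((\<lambda>t. \<tau> * (h (v t) - h (u t)) - (hamiltonian0 b f t (y t) (p t) (v t) -
        hamiltonian0 b f t (x t) (p t) (u t) - (p t \<bullet> bx t (x t) (u t) (y t - x t) - fx t (x t) (u t) (y t - x t))))
      has_integral
      integral {0..T} (\<lambda>t. f t (y t) (v t) + \<tau> * h (v t)) - integral {0..T} (\<lambda>t. f t (x t) (u t) + \<tau> * h (u t))
        - - (gradient g (x T) \<bullet> (y T - x T))) {0..T}"
    by (rule has_integral_eq[rotated]) (subst p', simp_all add: hamiltonian0_def algebra_simps)
  then show ?thesis
    by (simp add: cost_def Let_def has_integral_iff flip: x_def y_def)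
qed

text \<open>Divided by \<open>e\<close>, the exact cost difference splits into the quotient
  \<open>A\<close> of \<open>h\<close>, the Hamiltonian part \<open>R\<close> and the terminal part
  \<open>\<rho>\<close>. The first two converge uniformly in time, which permits passing to the
  limit under the integral, and \<open>\<rho>\<close> vanishes because the remainder of
  \<open>g\<close> is quadratic in a state change of order \<open>e\<close>.\<close>

lemma cost_has_directional_derivative:
  assumes u: "u \<in> controls T U" and v: "v \<in> controls T U"
    and b: "uniform_expansion T U b bx bu Cb" and f: "uniform_expansion T U f fx fu Cf"
    and h': "\<And>z. z \<in> U \<Longrightarrow> (h has_derivative (\<lambda>w. h' z \<bullet> w)) (at z within U)"
    and h'c: "continuous_on U h'"
  defines "x \<equiv> state T x0 b u" and "p \<equiv> costate T x0 b f g u"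
  shows "directional_derivative (cost T x0 \<tau> b f g h) u (\<lambda>t. v t - u t)
    = - integral {0..T} (\<lambda>t. p t \<bullet> bu t (x t) (u t) (v t - u t) - fu t (x t) (u t) (v t - u t)
        - \<tau> * (h' (u t) \<bullet> (v t - u t)))"
proof -
  define z where "z e t = u t + e *\<^sub>R (v t - u t)" for e t
  define y where "y e = state T x0 b (z e)" for e
  define H where "H t x u = hamiltonian0 b f t x (p t) u" for t x u
  define Hx where "Hx t x u \<xi> = p t \<bullet> bx t x u \<xi> - fx t x u \<xi>" for t x u \<xi>
  define Hu where "Hu t x u w = p t \<bullet> bu t x u w - fu t x u w" for t x u w
  have uv: "continuous_on {0..T} u" "continuous_on {0..T} v"
    "\<And>t. t \<in> {0..T} \<Longrightarrow> u t \<in> U" "\<And>t. t \<in> {0..T} \<Longrightarrow> v t \<in> U"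
    using u v by (auto simp: controls_def)
  have z: "z e \<in> controls T U" if "e \<in> {0<..<1}" for e
    unfolding z_def using that by (intro controls_segment U_convex u v) auto
  have hc: "continuous_on U h"
    by (rule has_derivative_continuous_on[OF h'])
  have xc: "continuous_on {0..T} x" and pc: "continuous_on {0..T} p"
    unfolding x_def p_def by (intro state_continuous costate_continuous u)+
  have yc: "continuous_on {0..T} (y e)" if "e \<in> {0<..<1}" for e
    unfolding y_def by (intro state_continuous z that)
  obtain C where H: "uniform_expansion T U H Hx Hu C"
    using uniform_expansion_hamiltonian0[OF b f pc] unfolding H_def Hx_def Hu_def by blast
  obtain W where "W > 0" and W: "\<And>t. t \<in> {0..T} \<Longrightarrow> norm (v t - u t) \<le> W"
    using bounded_on_interval[of T "\<lambda>t. v t - u t"] uv by (auto intro: continuous_on_diff)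
  define K where "K = 2 * M * T * exp (2 * M * T) * W"
  have "K \<ge> 0"
    using M_pos T_pos \<open>W > 0\<close> by (simp add: K_def)
  have yx: "norm (y e t - x t) \<le> e * K" if e: "e \<in> {0<..<1}" and t: "t \<in> {0..T}" for e t
  proof -
    have "norm (z e r - u r) \<le> e * W" if "r \<in> {0..T}" for r
      using W[OF that] e by (simp add: z_def)
    from state_stability[OF u z[OF e] this t] show ?thesis
      by (simp add: y_def x_def K_def mult_ac)
  qed
  define A where "A e t = (h (z e t) - h (u t)) / e" for e t
  \<comment> \<open>The x-linear term has already been removed by the adjoint identity, so up to an
    error of order \<open>e\<close> only the u-derivative is left.\<close>
  define R where "R e t = (H t (y e t) (z e t) - H t (x t) (u t) - Hx t (x t) (u t) (y e t - x t)) / e" for e t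
  define \<rho> where "\<rho> e = (g (y e T) - g (x T) - gradient g (x T) \<bullet> (y e T - x T)) / e" for e
  have "uniform_limit {0..T} A (\<lambda>t. h' (u t) \<bullet> (v t - u t)) (at_right 0)"
    unfolding A_def z_def by (rule uniform_limit_difference_quotient[OF U_convex u v h' h'c])
  moreover have "uniform_limit {0..T} R (\<lambda>t. Hu t (x t) (u t) (v t - u t)) (at_right 0)"
  proof (rule uniform_limit_at_right_0I)
    fix e t :: real assume e: "e \<in> {0<..<1}" and t: "t \<in> {0..T}"
    let ?r = "H t (y e t) (z e t) - H t (x t) (u t) - Hx t (x t) (u t) (y e t - x t) - Hu t (x t) (u t) (z e t - u t)"
    have "norm ?r \<le> C * (norm (y e t - x t) + norm (z e t - u t))\<^sup>2"
      using z[OF e] t by (intro uniform_expansionD(5)[OF H] uv) (auto simp: controls_def)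
    also have "\<dots> \<le> C * (e * K + e * W)\<^sup>2"
      using yx[OF e t] W[OF t] e uniform_expansionD(1)[OF H]
      by (intro mult_left_mono power_mono add_mono) (auto simp: z_def)
    also have "\<dots> = e * (e * (C * (K + W)\<^sup>2))"
      by (simp add: power2_eq_square algebra_simps)
    also have "?r = e * (R e t - Hu t (x t) (u t) (v t - u t))"
    proof -
      have "Hu t (x t) (u t) (z e t - u t) = e * Hu t (x t) (u t) (v t - u t)"
        using uniform_expansionD(7)[OF H t uv(3)[OF t]] by (simp add: z_def linear_scale)
      then show ?thesis
        using e by (simp add: R_def field_simps)
    qed
    finally show "norm (R e t - Hu t (x t) (u t) (v t - u t)) \<le> e * (C * (K + W)\<^sup>2)"
      using e by (simp add: abs_mult)
  qed
  ultimately have "uniform_limit {0..T} (\<lambda>e t. \<tau> * A e t - R e t)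
      (\<lambda>t. \<tau> * (h' (u t) \<bullet> (v t - u t)) - Hu t (x t) (u t) (v t - u t)) (at_right 0)"
    by (intro uniform_limit_minus bounded_linear.uniform_limit[OF bounded_linear_mult_right])
  moreover have "continuous_on {0..T} (\<lambda>t. \<tau> * A e t - R e t)" if e: "e \<in> {0<..<1}" for e
    unfolding A_def R_def using e z[OF e]
    by (intro continuous_intros continuous_on_compose2[OF hc] continuous_on_paths[OF uniform_expansionD(2)[OF H]]
        uniform_expansion_partial_derivatives_continuous[OF H U_convex] u xc yc uv)
       (use uv in \<open>auto simp: controls_def\<close>)
  then have "\<forall>\<^sub>F e in at_right 0. continuous_on {0..T} (\<lambda>t. \<tau> * A e t - R e t)"
    by (intro eventually_at_rightI[where b = 1]) auto
  moreover have "continuous_on {0..T} (\<lambda>t. \<tau> * (h' (u t) \<bullet> (v t - u t)) - Hu t (x t) (u t) (v t - u t))"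
    by (intro continuous_intros continuous_on_compose2[OF h'c]
        uniform_expansion_partial_derivatives_continuous[OF H U_convex] u v xc uv)
       (use uv in auto)
  ultimately have "((\<lambda>e. integral {0..T} (\<lambda>t. \<tau> * A e t - R e t)) \<longlongrightarrow>
      integral {0..T} (\<lambda>t. \<tau> * (h' (u t) \<bullet> (v t - u t)) - Hu t (x t) (u t) (v t - u t))) (at_right 0)"
    using T_pos by (intro uniform_limit_integral_tendsto) auto
  moreover have "(\<rho> \<longlongrightarrow> 0) (at_right 0)"
  proof (rule tendsto_0_le)
    show "((\<lambda>e::real. e) \<longlongrightarrow> 0) (at_right 0)"
      by (rule tendsto_ident_at)
    have "norm (\<rho> e) \<le> norm e * (M * K\<^sup>2)" if e: "e \<in> {0<..<1}" for e
    proof -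
      have "e * \<bar>\<rho> e\<bar> \<le> M * (norm (y e T - x T))\<^sup>2"
        using g_remainder[of "y e T" "x T"] e by (simp add: \<rho>_def)
      also have "\<dots> \<le> M * (e * K)\<^sup>2"
        using yx[OF e, of T] T_pos M_pos by (intro mult_left_mono power_mono) auto
      also have "\<dots> = e * (e * (M * K\<^sup>2))"
        by (simp add: power2_eq_square mult_ac)
      finally show ?thesis
        using e by simp
    qed
    then show "\<forall>\<^sub>F e in at_right 0. norm (\<rho> e) \<le> norm e * (M * K\<^sup>2)"
      by (intro eventually_at_rightI[where b = 1]) auto
  qed
  ultimately have "((\<lambda>e. integral {0..T} (\<lambda>t. \<tau> * A e t - R e t) + \<rho> e) \<longlongrightarrow>
      integral {0..T} (\<lambda>t. \<tau> * (h' (u t) \<bullet> (v t - u t)) - Hu t (x t) (u t) (v t - u t)) + 0) (at_right 0)"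
    by (rule tendsto_add)
  moreover have "integral {0..T} (\<lambda>t. \<tau> * A e t - R e t) + \<rho> e
      = (cost T x0 \<tau> b f g h (z e) - cost T x0 \<tau> b f g h u) / e" if e: "e \<in> {0<..<1}" for e
  proof -
    have "integral {0..T} (\<lambda>t. \<tau> * A e t - R e t)
        = integral {0..T} (\<lambda>t. (\<tau> * (h (z e t) - h (u t)) -
            (H t (y e t) (z e t) - H t (x t) (u t) - Hx t (x t) (u t) (y e t - x t))) / e)"
      by (simp add: A_def R_def flip: diff_divide_distrib)
    then show ?thesis
      using cost_difference[OF u z[OF e] b f hc]
      by (simp add: \<rho>_def H_def Hx_def x_def p_def y_def add_divide_distrib)
  qed
  then have "\<forall>\<^sub>F e in at_right 0. integral {0..T} (\<lambda>t. \<tau> * A e t - R e t) + \<rho> e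
      = (cost T x0 \<tau> b f g h (z e) - cost T x0 \<tau> b f g h u) / e"
    by (intro eventually_at_rightI[where b = 1]) auto
  ultimately have "((\<lambda>e. (cost T x0 \<tau> b f g h (z e) - cost T x0 \<tau> b f g h u) / e) \<longlongrightarrow>
      integral {0..T} (\<lambda>t. \<tau> * (h' (u t) \<bullet> (v t - u t)) - Hu t (x t) (u t) (v t - u t)) + 0) (at_right 0)"
    by (rule Lim_transform_eventually)
  \<comment> \<open>\<open>Lim\<close> is a definite description: its value is known only after
    convergence along the nontrivial filter \<open>at_right 0\<close> has been shown.\<close>
  then have "directional_derivative (cost T x0 \<tau> b f g h) u (\<lambda>t. v t - u t)
      = integral {0..T} (\<lambda>t. \<tau> * (h' (u t) \<bullet> (v t - u t)) - Hu t (x t) (u t) (v t - u t))"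
    unfolding directional_derivative_def z_def by (intro tendsto_Lim) auto
  then show ?thesis
    by (simp add: Hu_def flip: integral_neg)
qed

section \<open>A single mirror descent step\<close>

lemma gradient_hamiltonian_inner:
  assumes b: "uniform_expansion T U b bx bu Cb" and f: "uniform_expansion T U f fx fu Cf"
    and h': "\<And>z. z \<in> U \<Longrightarrow> (h has_derivative (\<lambda>w. h' z \<bullet> w)) (at z within U)"
    and "t \<in> {0..T}" "u \<in> U" "v \<in> U"
  shows "gradient_within (hamiltonian \<tau> b f h t x p) U u \<bullet> (v - u)
    = p \<bullet> bu t x u (v - u) - fu t x u (v - u) - \<tau> * (h' u \<bullet> (v - u))"
proof -
  have "(hamiltonian \<tau> b f h t x p has_derivative (\<lambda>w. p \<bullet> bu t x u w - fu t x u w - \<tau> * (h' u \<bullet> w)))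
      (at u within U)"
    unfolding hamiltonian_def[abs_def] hamiltonian0_def
    by (intro has_derivative_diff has_derivative_inner_right has_derivative_mult_right h'
        uniform_expansionD(4)[OF b] uniform_expansionD(4)[OF f] assms)
  from gradient_within_inner[OF U_convex _ _ this] show ?thesis
    using assms by simp
qed

lemma mirror_step:
  assumes strong: "\<And>v w. v \<in> U \<Longrightarrow> w \<in> U \<Longrightarrow> bregman U h v w \<ge> \<sigma> / 2 * (norm (v - w))\<^sup>2"
    and "\<sigma> > 0" "lam > 0" and u: "u \<in> controls T U"
    and step: "\<And>t. t \<in> {0..T} \<Longrightarrow> is_arg_max
        (\<lambda>v. gradient_within (hamiltonian \<tau> b f h t (state T x0 b u t) (costate T x0 b f g u t)) U (u t) \<bullet> (v - u t)
              - lam * bregman U h v (u t)) (\<lambda>v. v \<in> U) (w t)"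
  shows "w \<in> controls T U"
    and "directional_derivative (cost T x0 \<tau> b f g h) u (\<lambda>t. w t - u t) \<le> - lam * path_bregman T U h w u"
proof -
  define x where "x = state T x0 b u"
  define p where "p = costate T x0 b f g u"
  obtain bx bu Cb fx fu Cf
    where b: "uniform_expansion T U b bx bu Cb" and f: "uniform_expansion T U f fx fu Cf"
    by (rule b_f_expansion)
  obtain h' where h': "\<And>z. z \<in> U \<Longrightarrow> (h has_derivative (\<lambda>w. h' z \<bullet> w)) (at z within U)"
    and h'c: "continuous_on U h'"
    using h_C1 by (auto simp: C1_on_def)
  have uU: "u t \<in> U" if "t \<in> {0..T}" for t
    using u that by (auto simp: controls_def)
  have uc: "continuous_on {0..T} u"
    using u by (auto simp: controls_def)
  have xc: "continuous_on {0..T} x" and pc: "continuous_on {0..T} p"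
    unfolding x_def p_def by (intro state_continuous costate_continuous u)+
  \<comment> \<open>\<open>c t\<close> agrees with the chosen Hamiltonian gradient on feasible
    directions; being explicit, it has a continuity in time that can be proved.\<close>
  define c where "c t w = p t \<bullet> bu t (x t) (u t) w - fu t (x t) (u t) w - \<tau> * (h' (u t) \<bullet> w)" for t w
  have c: "gradient_within (hamiltonian \<tau> b f h t (x t) (p t)) U (u t) \<bullet> (v - u t) = c t (v - u t)"
    if "t \<in> {0..T}" "v \<in> U" for t v
    unfolding c_def using that by (intro gradient_hamiltonian_inner[OF b f h'] uU)
  have breg: "bregman U h v (u t) = h v - h (u t) - h' (u t) \<bullet> (v - u t)" if "t \<in> {0..T}" "v \<in> U" for t v
    using gradient_within_inner[OF U_convex uU[OF that(1)] that(2) h'[OF uU[OF that(1)]]]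
    by (simp add: bregman_def)
  have h'uc: "continuous_on {0..T} (\<lambda>t. h' (u t))"
    by (rule continuous_on_compose2[OF h'c uc]) (use uU in auto)
  have cc: "continuous_on {0..T} (\<lambda>t. c t (v t - u t))" if "v \<in> controls T U" for v
    unfolding c_def using that
    by (intro continuous_intros pc h'uc uc uniform_expansion_partial_derivatives_continuous[OF b U_convex xc u]
        uniform_expansion_partial_derivatives_continuous[OF f U_convex xc u])
       (auto simp: controls_def)
  have wU: "w t \<in> U" and
    wmax: "\<And>v. v \<in> U \<Longrightarrow> c t (v - u t) - lam * bregman U h v (u t) \<le> c t (w t - u t) - lam * bregman U h (w t) (u t)"
    if t: "t \<in> {0..T}" for t
  proof -
    show wU: "w t \<in> U"
      using step[OF t] by (simp add: is_arg_max_def)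
    show "c t (v - u t) - lam * bregman U h v (u t) \<le> c t (w t - u t) - lam * bregman U h (w t) (u t)"
      if "v \<in> U" for v
      using step[OF t] that unfolding is_arg_max_def x_def[symmetric] p_def[symmetric]
      by (auto simp: c[OF t] wU not_less)
  qed
  \<comment> \<open>Expanding the Bregman term contributes
    \<open>lam * (h' (u t) \<bullet> v)\<close> to the linear part. Up to terms constant in
    \<open>v\<close> the objective is \<open>a t \<bullet> v - lam * h v\<close>, the form required
    for continuity of maximizers.\<close>
  obtain a where a: "continuous_on {0..T} a"
    and ac: "\<And>t v w. t \<in> {0..T} \<Longrightarrow> v \<in> U \<Longrightarrow> w \<in> U \<Longrightarrow>
      a t \<bullet> (v - w) = c t (v - w) + lam * (h' (u t) \<bullet> (v - w))"
  proof (rule continuous_functional_representation[of "{0..T}" "\<lambda>t w. c t w + lam * (h' (u t) \<bullet> w)" u U])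
    fix t assume "t \<in> {0..T}"
    then have "linear (bu t (x t) (u t))" "linear (fu t (x t) (u t))"
      using uniform_expansionD(7)[OF b] uniform_expansionD(7)[OF f] uU by auto
    then show "linear (\<lambda>w. c t w + lam * (h' (u t) \<bullet> w))"
      unfolding c_def by (intro linearI) (simp_all add: linear_add linear_scale algebra_simps)
  next
    \<comment> \<open>A point of \<open>U\<close> is a constant control, so continuity along
      controls applies to it.\<close>
    fix v assume "v \<in> U"
    then show "continuous_on {0..T} (\<lambda>t. c t (v - u t) + lam * (h' (u t) \<bullet> (v - u t)))"
      by (intro continuous_intros h'uc uc cc[of "\<lambda>_. v"]) (auto simp: controls_def)
  qed (use uU in auto)
  have "continuous_on {0..T} w"
  proof (rule strongly_concave_arg_max_continuous[OF U_convex \<open>lam > 0\<close> \<open>\<sigma> > 0\<close> strong a])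
    fix t v assume t: "t \<in> {0..T}" and v: "v \<in> U"
    have "a t \<bullet> (v - u t) - a t \<bullet> (w t - u t) \<le> lam * h v - lam * h (w t)"
      using wmax[OF t v] unfolding ac[OF t v uU[OF t]] ac[OF t wU[OF t] uU[OF t]] breg[OF t v] breg[OF t wU[OF t]]
      by (simp add: algebra_simps)
    then show "a t \<bullet> v - lam * h v \<le> a t \<bullet> w t - lam * h (w t)"
      by (simp add: inner_diff_right)
  qed (use wU in auto)
  then show w: "w \<in> controls T U"
    using wU by (auto simp: controls_def)
  have bc: "continuous_on {0..T} (\<lambda>t. bregman U h (w t) (u t))"
    by (rule path_bregman_integrand_continuous[OF U_convex h_C1 u w])
  have "lam * path_bregman T U h w u = integral {0..T} (\<lambda>t. lam * bregman U h (w t) (u t))"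
    by (simp add: path_bregman_def)
  also have "\<dots> \<le> integral {0..T} (\<lambda>t. c t (w t - u t))"
  proof (rule integral_le)
    fix t assume t: "t \<in> {0..T}"
    have "c t (u t - u t) = 0"
      using uniform_expansionD(7)[OF b t uU[OF t]] uniform_expansionD(7)[OF f t uU[OF t]]
      by (simp add: c_def linear_0)
    then show "lam * bregman U h (w t) (u t) \<le> c t (w t - u t)"
      using wmax[OF t uU[OF t]] by (simp add: bregman_def)
  qed (intro integrable_continuous_real continuous_intros bc cc w)+
  finally show "directional_derivative (cost T x0 \<tau> b f g h) u (\<lambda>t. w t - u t) \<le> - lam * path_bregman T U h w u"
    using cost_has_directional_derivative[OF u w b f h' h'c] by (simp add: c_def x_def p_def)
qed

lemma path_bregman_nonneg:
  assumes "\<And>v w. v \<in> U \<Longrightarrow> w \<in> U \<Longrightarrow> bregman U h v w \<ge> 0" "u \<in> controls T U" "v \<in> controls T U"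
  shows "path_bregman T U h v u \<ge> 0"
  unfolding path_bregman_def
proof (rule integral_nonneg)
  show "(\<lambda>t. bregman U h (v t) (u t)) integrable_on {0..T}"
    by (intro integrable_continuous_real path_bregman_integrand_continuous[OF U_convex h_C1 assms(2,3)])
  show "bregman U h (v t) (u t) \<ge> 0" if "t \<in> {0..T}" for t
    using assms(2,3) that by (intro assms(1)) (auto simp: controls_def)
qed

end

text \<open>\<open>J\<close> decreases and is bounded below, hence converges; its increments tend to
  0 and, divided by \<open>k\<close>, dominate \<open>D\<close>.\<close>

lemma tendsto_0_of_sufficient_decrease:
  fixes J D :: "nat \<Rightarrow> real"
  assumes "k > 0" and decr: "\<And>n. J n - J (Suc n) \<ge> k * D n" and D: "\<And>n. D n \<ge> 0"
    and "bdd_below (range J)"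
  shows "D \<longlonglongrightarrow> 0"
proof -
  have "decseq J"
  proof (rule decseq_SucI)
    show "J (Suc n) \<le> J n" for n
      using order_trans[OF mult_nonneg_nonneg[OF less_imp_le[OF \<open>k > 0\<close>] D] decr, of n] by simp
  qed
  then obtain l where l: "J \<longlonglongrightarrow> l"
    using \<open>bdd_below (range J)\<close> decseq_convergent[of J] unfolding bdd_below_def by blast
  have "(\<lambda>n. J n - J (Suc n)) \<longlonglongrightarrow> l - l"
    by (intro tendsto_diff l LIMSEQ_Suc)
  then have lim: "(\<lambda>n. J n - J (Suc n)) \<longlonglongrightarrow> 0"
    by simp
  show ?thesis
  proof (rule tendsto_0_le[OF lim])
    have "norm (D n) \<le> norm (J n - J (Suc n)) * (1 / k)" for n
      using decr[of n] D[of n] \<open>k > 0\<close> mult_nonneg_nonneg[of k "D n"]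
      by (simp add: field_simps)
    then show "\<forall>\<^sub>F n in sequentially. norm (D n) \<le> norm (J n - J (Suc n)) * (1 / k)"
      by simp
  qed
qed

theorem theorem3:
  fixes T \<tau> M Mbuu Mfuu \<sigma> L lam :: real
    and x0 :: "real ^ 'd"
    and U :: "(real ^ 'm) set"
    and b :: "real \<Rightarrow> real ^ 'd \<Rightarrow> real ^ 'm \<Rightarrow> real ^ 'd"
    and f :: "real \<Rightarrow> real ^ 'd \<Rightarrow> real ^ 'm \<Rightarrow> real"
    and g :: "real ^ 'd \<Rightarrow> real"
    and h :: "real ^ 'm \<Rightarrow> real"
    and u0 :: "real \<Rightarrow> real ^ 'm"
    and u :: "nat \<Rightarrow> real \<Rightarrow> real ^ 'm"
  defines "J \<equiv> cost T x0 \<tau> b f g h"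
  assumes "control_problem T x0 \<tau> U b f g h M Mbuu Mfuu"
    and "\<sigma> > 0"
    and "\<forall>u\<in>U. \<forall>v\<in>U. bregman U h v u \<ge> \<sigma> / 2 * (norm (v - u))\<^sup>2"
    and "L > 0"
    and "relatively_smooth T U h J L"
    and "lam \<ge> L"
    and "u0 \<in> controls T U"
    and "mirror_descent T x0 \<tau> U b f g h lam u0 u"
  shows "(\<forall>n. J (u n) - J (u (Suc n)) \<ge> (lam - L) * path_bregman T U h (u (Suc n)) (u n) \<and>
              (lam - L) * path_bregman T U h (u (Suc n)) (u n) \<ge> 0) \<and>
         (lam > L \<and> bdd_below (J ` controls T U) \<longrightarrow>
              (\<lambda>n. path_bregman T U h (u (Suc n)) (u n)) \<longlonglongrightarrow> 0)"
proof -
  interpret control_problem T x0 \<tau> U b f g h M Mbuu Mfuu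
    by fact
  define D where "D n = path_bregman T U h (u (Suc n)) (u n)" for n
  have strong: "bregman U h v w \<ge> \<sigma> / 2 * (norm (v - w))\<^sup>2" if "v \<in> U" "w \<in> U" for v w
    using assms(4) that by blast
  have "lam > 0"
    using assms by simp
  have step: "is_arg_max
      (\<lambda>v. gradient_within (hamiltonian \<tau> b f h t (state T x0 b (u n) t) (costate T x0 b f g (u n) t)) U (u n t)
            \<bullet> (v - u n t) - lam * bregman U h v (u n t)) (\<lambda>v. v \<in> U) (u (Suc n) t)"
    if "t \<in> {0..T}" for n t
    using assms(9) that by (simp add: mirror_descent_def Let_def)
  \<comment> \<open>The algorithm constrains each time separately, so membership in
    \<open>controls\<close> is propagated by induction before relative smoothness can be applied to
    consecutive iterates.\<close>
  have u: "u n \<in> controls T U" for n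
  proof (induction n)
    case 0
    then show ?case
      using assms by (simp add: mirror_descent_def)
  next
    case (Suc n)
    show ?case
      by (rule mirror_step(1)[OF strong \<open>\<sigma> > 0\<close> \<open>lam > 0\<close> Suc step])
  qed
  have D: "D n \<ge> 0" for n
    unfolding D_def
  proof (rule path_bregman_nonneg[OF _ u u])
    fix v w assume "v \<in> U" "w \<in> U"
    have "0 \<le> \<sigma> / 2 * (norm (v - w))\<^sup>2"
      using \<open>\<sigma> > 0\<close> by simp
    then show "bregman U h v w \<ge> 0"
      using strong[OF \<open>v \<in> U\<close> \<open>w \<in> U\<close>] by linarith
  qed
  have decr: "(lam - L) * D n \<le> J (u n) - J (u (Suc n))" for n
  proof -
    have "J (u (Suc n)) - J (u n) \<le> directional_derivative J (u n) (\<lambda>t. u (Suc n) t - u n t) + L * D n"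
      using assms(6) u unfolding relatively_smooth_def D_def by blast
    also have "directional_derivative J (u n) (\<lambda>t. u (Suc n) t - u n t) \<le> - lam * D n"
      unfolding J_def D_def by (rule mirror_step(2)[OF strong \<open>\<sigma> > 0\<close> \<open>lam > 0\<close> u step])
    finally show ?thesis
      by (simp add: algebra_simps)
  qed
  have "D \<longlonglongrightarrow> 0" if "lam > L" "bdd_below (J ` controls T U)"
  proof (rule tendsto_0_of_sufficient_decrease[where J = "\<lambda>n. J (u n)" and k = "lam - L"])
    show "bdd_below (range (\<lambda>n. J (u n)))"
      by (rule bdd_below_mono[OF that(2)]) (use u in auto)
  qed (use that decr D in auto)
  then show ?thesis
    using decr D \<open>lam \<ge> L\<close> by (auto simp: D_def[abs_def])
qed

end
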